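(* Let $\alpha\in\mathbb{C}$ with $\operatorname{Re}(\alpha)>0$ and $\operatorname{Im}(\alpha)>-1$. Then $$\int_{-\infty}^{\infty}\binom{i\alpha}{x}\,\mathrm{sech}\!\left(\frac{\pi x}{\alpha}\right)dx=\frac{\alpha\,2^{i\alpha}}{\sqrt{\pi}}\,\frac{\Gamma\!\left(\frac{i\alpha}{2}+\frac12\right)}{\Gamma\!\left(\frac{i\alpha}{2}+1\right)}.$$
   Context: For $w\in\mathbb{C}$ not a negative integer and $z\in\mathbb{C}$, the generalized binomial coefficient is $\binom{w}{z}=\frac{\Gamma(w+1)}{\Gamma(z+1)\Gamma(w-z+1)}$, where the reciprocal gamma function $1/\Gamma$ is understood as an entire function (equal to $0$ at the nonpositive integers). Here $\mathrm{sech}=1/\cosh$ and $2^{i\alpha}=e^{i\alpha\ln 2}$. *)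

theory Defs
  imports "HOL-Complex_Analysis.Complex_Analysis"
begin

(* rGamma is the library's entire reciprocal Gamma function, so the value is 0 where
   z + 1 or w - z + 1 is a nonpositive integer; w is not meant to be a negative integer. *)
definition complex_binomial :: "complex \<Rightarrow> complex \<Rightarrow> complex" where
  "complex_binomial w z = Gamma (w + 1) * rGamma (z + 1) * rGamma (w - z + 1)"

definition sech :: "complex \<Rightarrow> complex" where
  "sech z = 1 / cosh z"

end

(* Put w = i alpha.  Both sides are holomorphic in alpha on Re alpha > 0, so it suffices to treat
   real alpha > 0.  There binom(w, x) = 2^w / pi times the integral over (-pi/2, pi/2) of
   cos(t)^w exp(i (w - 2 x) t), and by Fubini the integral over x becomes the Fourier transform of
   sech, which is again a sech.  Since exp(i w t) = exp(- alpha t), symmetrising under t -> -t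
   cancels it and leaves the integral of cos(t)^w.

   Cauchy's formula for the integral of cos(t)^w exp(i u t) follows by iterating the recurrence
   w -> w + 2: the integral for w + 2 n and u is asymptotic to that for 2 n and 0 as n -> infinity.
   For Re w < 0 the growth in x needed for dominated convergence comes from
   binom(w, x) = binom(w + 1, x) (w + 1 - x) / (w + 1). *)
theory Submission
  imports Defs
begin

text \<open>For real alpha > 0 the exponent \<open>w\<close> is purely imaginary, and this boundary
  case shapes the first half of the proof: \<open>cos t ^ w\<close> then has modulus one and
  oscillates without a limit at the ends of the interval, so every boundary term must carry an extra
  power of \<open>cos t\<close>. Cauchy's formula is nevertheless wanted on all of Re w >= 0,
  because it also yields the growth bound that dominates the integrand near a complex alpha. The
  second argument is \<open>u = w - 2 x\<close>; for real x its imaginary part does not depend on x,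
  so crude estimates of the integral are already uniform in x. Non-real alpha is left to
  continuation because the substitution x = alpha y behind the Fourier transform would turn the real
  line into another line. The half-plane Re alpha > 0 is Im w > 0: there \<open>w + 1\<close> is
  neither zero nor a pole of Gamma, and \<open>sech (pi x / alpha)\<close> has no pole for real x
  and decays at a rate that is locally uniform in alpha.\<close>

section \<open>The integral of cos t ^ w against exp (i u t)\<close>

definition cosker :: "complex \<Rightarrow> complex \<Rightarrow> real \<Rightarrow> complex" where
  "cosker w u t = exp (w * of_real (ln (cos t)) + \<i> * u * of_real t)"

text \<open>The interval is open because at its end points \<open>ln\<close> is evaluated at 0,
  where the kernel no longer represents \<open>cos t ^ w\<close>.\<close>

definition cosint :: "complex \<Rightarrow> complex \<Rightarrow> complex" where
  "cosint w u = (LINT t:{-pi/2<..<pi/2}|lborel. cosker w u t)"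

lemma cos_pos_half_pi: "t \<in> {-pi/2<..<pi/2} \<Longrightarrow> 0 < cos (t::real)"
  using cos_gt_zero_pi[of t] by auto

lemma norm_cosker: "norm (cosker w u t) = exp (Re w * ln (cos t) - Im u * t)"
  by (simp add: cosker_def)

lemma norm_cosker_le:
  assumes "Re w \<ge> 0" "t \<in> {-pi/2<..<pi/2}"
  shows "norm (cosker w u t) \<le> exp (\<bar>Im u\<bar> * (pi/2))"
proof -
  have "ln (cos t) \<le> 0" using cos_pos_half_pi[OF assms(2)] by simp
  then have "Re w * ln (cos t) \<le> 0" using assms(1) by (simp add: mult_nonneg_nonpos)
  moreover have "\<bar>Im u * t\<bar> \<le> \<bar>Im u\<bar> * (pi/2)"
    unfolding abs_mult using assms(2) by (intro mult_left_mono) auto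
  ultimately show ?thesis by (auto simp: norm_cosker)
qed

lemma cosker_measurable [measurable]: "cosker w u \<in> borel_measurable borel"
  unfolding cosker_def by measurable

lemma cosker_set_integrable:
  assumes "Re w \<ge> 0"
  shows "set_integrable lborel {-pi/2<..<pi/2} (cosker w u)"
  unfolding set_integrable_def
proof (rule integrableI_bounded_set_indicator)
  show "AE t\<in>{-pi/2<..<pi/2} in lborel. norm (cosker w u t) \<le> exp (\<bar>Im u\<bar> * (pi/2))"
    using norm_cosker_le[OF assms] by auto
qed (auto)

text \<open>Only \<open>Im u\<close> enters the bound, so at \<open>u = w - 2 * x\<close> it is the
  same for all real x.\<close>

lemma norm_cosint_le:
  assumes "Re w \<ge> 0"
  shows "norm (cosint w u) \<le> pi * exp (\<bar>Im u\<bar> * (pi/2))"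
proof -
  have "norm (cosint w u) \<le> (LINT t:{-pi/2<..<pi/2}|lborel. norm (cosker w u t))"
    unfolding cosint_def by (rule set_integral_norm_bound[OF cosker_set_integrable[OF assms]])
  also have "\<dots> \<le> (LINT t:{-pi/2<..<pi/2}|lborel. exp (\<bar>Im u\<bar> * (pi/2)))"
    using norm_cosker_le[OF assms] set_integrable_norm[OF cosker_set_integrable[OF assms]]
    by (intro set_integral_mono) (auto simp: set_integrable_def)
  also have "\<dots> = pi * exp (\<bar>Im u\<bar> * (pi/2))"
    by (simp add: set_integral_const)
  finally show ?thesis .
qed

lemma cosint_has_integral:
  assumes "Re w \<ge> 0"
  shows "(cosker w u has_integral cosint w u) {-pi/2..pi/2}"
proof -
  have "(cosker w u has_integral cosint w u) {-pi/2<..<pi/2}"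
    unfolding cosint_def using cosker_set_integrable[OF assms]
    by (metis has_integral_integral set_borel_integral_eq_integral)
  then show ?thesis
    by (simp add: has_integral_Icc_iff_Ioo)
qed

text \<open>For imaginary \<open>w\<close> the kernel itself has no limit at the end points, but it
  stays bounded, so the factor \<open>cos t\<close> forces the limit 0. Continuity up to the ends is
  what the fundamental theorem of calculus asks for when the derivative exists only inside.\<close>

lemma continuous_on_cos_mult_cosker:
  assumes "Re w \<ge> 0"
  shows "continuous_on {-pi/2..pi/2} (\<lambda>t. of_real (cos t) * cosker w u t)"
  unfolding continuous_on_eq_continuous_within
proof
  fix t :: real assume t: "t \<in> {-pi/2..pi/2}"
  show "continuous (at t within {-pi/2..pi/2}) (\<lambda>t. of_real (cos t) * cosker w u t)"
  proof (cases "cos t = 0")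
    case False
    then have "isCont (\<lambda>t. of_real (cos t) * cosker w u t) t"
      unfolding cosker_def by (intro continuous_intros) auto
    then show ?thesis using continuous_at_imp_continuous_at_within by blast
  next
    case True
    let ?B = "exp (\<bar>Im u\<bar> * (pi/2))"
    have "((\<lambda>t. of_real (cos t) * cosker w u t) \<longlongrightarrow> 0) (at t within {-pi/2..pi/2})"
    proof (rule Lim_null_comparison)
      show "\<forall>\<^sub>F s in at t within {-pi/2..pi/2}.
              norm (of_real (cos s) * cosker w u s) \<le> \<bar>cos s\<bar> * ?B"
        unfolding eventually_at_filter
      proof (intro always_eventually allI impI)
        fix s assume "s \<in> {-pi/2..pi/2}"
        show "norm (of_real (cos s) * cosker w u s) \<le> \<bar>cos s\<bar> * ?B"
        proof (cases "s \<in> {-pi/2<..<pi/2}")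
          case True
          show ?thesis unfolding norm_mult norm_of_real
            by (rule mult_left_mono[OF norm_cosker_le[OF assms True]]) simp
        next
          case False
          then have "s = pi/2 \<or> s = -(pi/2)" using \<open>s \<in> _\<close> by auto
          then have "cos s = 0" by (elim disjE) (simp_all only: cos_minus cos_pi_half)
          then show ?thesis by simp
        qed
      qed
      have "isCont (\<lambda>s. \<bar>cos s\<bar> * ?B) t" by (intro continuous_intros)
      then have "(\<lambda>s. \<bar>cos s\<bar> * ?B) \<midarrow>t\<rightarrow> 0" using True by (simp add: isCont_def)
      then show "((\<lambda>s. \<bar>cos s\<bar> * ?B) \<longlongrightarrow> 0) (at t within {-pi/2..pi/2})"
        using tendsto_within_subset by blast
    qed
    then show ?thesis using True by (simp add: continuous_within)
  qed
qed

section \<open>The recurrence w -> w + 2 and its iteration\<close>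

lemma cosker_shift:
  assumes "t \<in> {-pi/2<..<pi/2}"
  shows "cosker (w + 2) u t = of_real (cos t) ^ 2 * cosker w u t"
proof -
  have "exp (2 * ln (cos t)) = cos t ^ 2"
    using cos_pos_half_pi[OF assms] by (simp add: exp_double)
  then have "exp (of_real (2 * ln (cos t))) = (of_real (cos t) ^ 2 :: complex)"
    by (simp add: exp_of_real del: of_real_mult)
  then show ?thesis
    by (simp add: cosker_def algebra_simps exp_add)
qed

lemma cosker_has_vector_derivative:
  assumes "t \<in> {-pi/2<..<pi/2}"
  shows "(cosker w u has_vector_derivative
            cosker w u t * (\<i> * u - w * of_real (sin t) / of_real (cos t))) (at t)"
proof -
  have "((\<lambda>t. ln (cos t)) has_real_derivative (- sin t / cos t)) (at t)"
    using cos_pos_half_pi[OF assms] by (auto intro!: derivative_eq_intros)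
  then have "((\<lambda>t. of_real (ln (cos t)) :: complex) has_vector_derivative of_real (- sin t / cos t)) (at t)"
    by (intro has_vector_derivative_of_real) (simp add: has_real_derivative_iff_has_vector_derivative)
  then have "((\<lambda>t. w * of_real (ln (cos t)) + \<i> * u * of_real t) has_vector_derivative
      w * of_real (- sin t / cos t) + \<i> * u * of_real 1) (at t)"
    by (intro has_vector_derivative_add has_vector_derivative_mult_right has_vector_derivative_of_real)
       (use cos_pos_half_pi[OF assms] in \<open>auto intro!: derivative_eq_intros\<close>)
  from field_vector_diff_chain_at[OF this DERIV_exp] show ?thesis
    unfolding cosker_def o_def by (simp add: algebra_simps)
qed

text \<open>The integrand on the left-hand side of the recurrence minus that on the right-hand side
  is the derivative of a function vanishing at both end points.\<close>

lemma cosint_recurrence: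
  assumes "Re w \<ge> 0"
  shows "(w + 1) * (w + 2) * cosint w u = ((w + 2)\<^sup>2 - u\<^sup>2) * cosint (w + 2) u"
proof -
  \<comment> \<open>\<open>F\<close> is the Wronskian f' e - f e' of f = cos t ^ (w + 2) and e = exp
    (i u t). Its derivative f'' e - f e'' contains no first derivatives: e'' = - u^2 e, and f'' = (w
    + 1) (w + 2) cos t ^ w - (w + 2)^2 cos t ^ (w + 2).\<close>
  define F where "F t = (of_real (cos t) * cosker w u t) *
     (- (w + 2) * of_real (sin t) - \<i> * u * of_real (cos t))" for t :: real
  have "((\<lambda>t. (w + 1) * (w + 2) * cosker w u t - ((w + 2)\<^sup>2 - u\<^sup>2) * cosker (w + 2) u t)
          has_integral (F (pi/2) - F (-pi/2))) {-pi/2..pi/2}"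
  proof (rule fundamental_theorem_of_calculus_interior)
    show "continuous_on {-pi/2..pi/2} F"
      unfolding F_def
      by (intro continuous_on_mult[OF continuous_on_cos_mult_cosker[OF assms]] continuous_intros)
    fix t :: real assume t: "t \<in> {-pi/2<..<pi/2}"
    let ?c = "of_real (cos t) :: complex" and ?s = "of_real (sin t) :: complex"
    have c0: "?c \<noteq> 0" using cos_pos_half_pi[OF t] by auto
    have sc: "?s * ?s = 1 - ?c * ?c"
      by (metis of_real_1 of_real_diff of_real_mult sin_squared_eq power2_eq_square)
    have ident: "(cosker w u t * (\<i> * u - w * ?s / ?c) * ?c - cosker w u t * ?s) * (-(w+2) * ?s - \<i> * u * ?c)
       + (?c * cosker w u t) * (-(w+2) * ?c + \<i> * u * ?s)
      = cosker w u t * ((w+1)*(w+2) - ((w + 2)\<^sup>2 - u\<^sup>2) * ?c^2)" (is "?L = ?R")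
    proof -
      have "?L = cosker w u t * ((\<i> * u * ?c - (w+1) * ?s) * (-(w+2) * ?s - \<i> * u * ?c)
          + ?c * (-(w+2) * ?c + \<i> * u * ?s))"
        using c0 by (simp add: field_simps)
      also have "(\<i> * u * ?c - (w+1) * ?s) * (-(w+2) * ?s - \<i> * u * ?c)
          + ?c * (-(w+2) * ?c + \<i> * u * ?s)
          = (w+1)*(w+2) * (?s * ?s) + u\<^sup>2 * ?c^2 - (w+2) * ?c^2"
        by (simp add: algebra_simps power2_eq_square)
      also have "\<dots> = (w+1)*(w+2) - ((w + 2)\<^sup>2 - u\<^sup>2) * ?c^2"
        unfolding sc by (simp add: algebra_simps power2_eq_square)
      finally show ?thesis .
    qed
    have "(F has_vector_derivative
       ((cosker w u t * (\<i> * u - w * ?s / ?c) * ?c - cosker w u t * ?s) * (-(w+2) * ?s - \<i> * u * ?c)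
       + (?c * cosker w u t) * (-(w+2) * ?c + \<i> * u * ?s))) (at t)"
      unfolding F_def
    proof -
      have 1: "((\<lambda>t. of_real (cos t) :: complex) has_vector_derivative of_real (- sin t)) (at t)"
              "((\<lambda>t. of_real (sin t) :: complex) has_vector_derivative of_real (cos t)) (at t)"
        by (auto intro!: has_vector_derivative_of_real derivative_eq_intros)
      note 2 = has_vector_derivative_mult[OF has_vector_derivative_mult[OF 1(1) cosker_has_vector_derivative[OF t]]
        has_vector_derivative_diff[OF has_vector_derivative_mult_right[OF 1(2), of "-(w+2)"]
            has_vector_derivative_mult_right[OF 1(1), of "\<i> * u"]]]
      show "((\<lambda>t. (of_real (cos t) * cosker w u t) *
             (- (w + 2) * of_real (sin t) - \<i> * u * of_real (cos t))) has_vector_derivative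
       ((cosker w u t * (\<i> * u - w * ?s / ?c) * ?c - cosker w u t * ?s) * (-(w+2) * ?s - \<i> * u * ?c)
       + (?c * cosker w u t) * (-(w+2) * ?c + \<i> * u * ?s))) (at t)"
        by (rule has_vector_derivative_eq_rhs[OF 2]) (simp add: algebra_simps)
    qed
    then show "(F has_vector_derivative (w + 1) * (w + 2) * cosker w u t
        - ((w + 2)\<^sup>2 - u\<^sup>2) * cosker (w + 2) u t) (at t)"
      unfolding ident cosker_shift[OF t] by (simp add: algebra_simps)
  qed auto
  moreover have "F (pi/2) = 0" "F (-pi/2) = 0" by (auto simp: F_def)
  ultimately have "((\<lambda>t. (w + 1) * (w + 2) * cosker w u t - ((w + 2)\<^sup>2 - u\<^sup>2) * cosker (w + 2) u t)
          has_integral 0) {-pi/2..pi/2}" by simp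
  moreover have "((\<lambda>t. (w + 1) * (w + 2) * cosker w u t - ((w + 2)\<^sup>2 - u\<^sup>2) * cosker (w + 2) u t)
          has_integral ((w + 1) * (w + 2) * cosint w u - ((w + 2)\<^sup>2 - u\<^sup>2) * cosint (w+2) u)) {-pi/2..pi/2}"
    using assms by (intro has_integral_diff has_integral_mult_right cosint_has_integral) auto
  ultimately have "0 = (w + 1) * (w + 2) * cosint w u - ((w + 2)\<^sup>2 - u\<^sup>2) * cosint (w+2) u"
    by (rule has_integral_unique)
  then show ?thesis by simp
qed

lemma cosker_shift_nat:
  assumes "t \<in> {-pi/2<..<pi/2}"
  shows "cosker (w + 2 * of_nat n) u t = of_real (cos t ^ (2 * n)) * cosker w u t"
proof (induction n)
  case (Suc n)
  have "cosker (w + 2 * of_nat (Suc n)) u t = cosker (w + 2 * of_nat n + 2) u t"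
    by (simp add: algebra_simps)
  then show ?case
    unfolding cosker_shift[OF assms] Suc by (simp add: power2_eq_square)
qed simp

text \<open>Divided by 4, the coefficients of the recurrence split into linear factors, each of
  which is the next factor of a Pochhammer symbol. Nothing is moved to a denominator, since the
  symbols containing \<open>u\<close> may vanish: at \<open>u = w - 2 * z\<close> one of them starts
  at \<open>z + 1\<close>.\<close>

lemma cosint_iterate:
  assumes "Re w \<ge> 0"
  shows "cosint (w + 2 * of_nat n) u * (pochhammer (1 + (w + u) / 2) n * pochhammer (1 + (w - u) / 2) n)
       = cosint w u * (pochhammer (1 + w / 2) n * pochhammer ((1 + w) / 2) n)"
proof (induction n)
  case (Suc n)
  define v where "v = w + 2 * of_nat n"
  have v: "Re v \<ge> 0" using assms by (simp add: v_def)
  have "cosint (v + 2) u * ((1 + (w + u) / 2 + of_nat n) * (1 + (w - u) / 2 + of_nat n))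
      = ((v + 2)\<^sup>2 - u\<^sup>2) * cosint (v + 2) u / 4"
    by (simp add: v_def field_simps power2_eq_square)
  also have "\<dots> = cosint v u * ((1 + w / 2 + of_nat n) * ((1 + w) / 2 + of_nat n))"
    unfolding cosint_recurrence[OF v, symmetric] by (simp add: v_def field_simps)
  finally have step: "cosint (v + 2) u * ((1 + (w + u) / 2 + of_nat n) * (1 + (w - u) / 2 + of_nat n))
      = cosint v u * ((1 + w / 2 + of_nat n) * ((1 + w) / 2 + of_nat n))" .
  have "w + 2 * of_nat (Suc n) = v + 2" by (simp add: v_def)
  then have "cosint (w + 2 * of_nat (Suc n)) u * (pochhammer (1 + (w + u) / 2) (Suc n) * pochhammer (1 + (w - u) / 2) (Suc n))
     = (cosint (v + 2) u * ((1 + (w + u) / 2 + of_nat n) * (1 + (w - u) / 2 + of_nat n)))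
       * (pochhammer (1 + (w + u) / 2) n * pochhammer (1 + (w - u) / 2) n)"
    by (simp only: pochhammer_Suc mult_ac)
  also have "\<dots> = (cosint v u * (pochhammer (1 + (w + u) / 2) n * pochhammer (1 + (w - u) / 2) n))
       * ((1 + w / 2 + of_nat n) * ((1 + w) / 2 + of_nat n))"
    unfolding step by (simp only: mult_ac)
  also have "\<dots> = cosint w u * (pochhammer (1 + w / 2) (Suc n) * pochhammer ((1 + w) / 2) (Suc n))"
    using Suc unfolding v_def by (simp only: pochhammer_Suc mult_ac)
  finally show ?case .
qed simp

lemma cosint_0_0: "cosint 0 0 = of_real pi"
  by (simp add: cosint_def cosker_def set_integral_const scaleR_conv_of_real)

text \<open>The Wallis integral. For \<open>w = u = 0\<close> three of the four Pochhammer symbols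
  are \<open>fact n\<close>, and one of these cancels.\<close>

lemma cosint_even:
  "cosint (2 * of_nat n) 0 * fact n = of_real pi * pochhammer (1 / 2) n"
proof -
  have "cosint (2 * of_nat n) 0 * (fact n * fact n) = of_real pi * (fact n * pochhammer (1/2) n)"
    using cosint_iterate[of 0 n 0] by (simp add: cosint_0_0 pochhammer_fact)
  then have "fact n * (cosint (2 * of_nat n) 0 * fact n) = fact n * (of_real pi * pochhammer (1/2) n)"
    by (simp only: mult_ac)
  then show ?thesis by simp
qed

lemma cosint_even_nonzero: "cosint (2 * of_nat n) 0 \<noteq> 0"
proof
  assume "cosint (2 * of_nat n) 0 = 0"
  then have "pochhammer (1 / 2 :: complex) n = 0" using cosint_even[of n] by auto
  then obtain k where "(1 / 2 :: complex) = - of_nat k" using pochhammer_eq_0_iff by blast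
  then have "Re (1/2) = Re (- of_nat k)" by (rule arg_cong)
  then have "(1/2 :: real) = - of_nat k" by (simp only: complex_Re_of_nat uminus_complex.sel) simp
  then show False by linarith
qed

section \<open>Asymptotics for large exponents\<close>

lemma tendsto_cosker_0: "((cosker w u) \<longlongrightarrow> 1) (at 0)"
proof -
  have "isCont (cosker w u) 0" unfolding cosker_def by (intro continuous_intros) auto
  then show ?thesis by (simp add: isCont_def cosker_def)
qed

text \<open>The normalised weights \<open>cos t ^ (2 * n)\<close> concentrate at \<open>0\<close>, where the kernel is \<open>1\<close>.\<close>

lemma cosint_ratio_tendsto:
  assumes "Re w \<ge> 0"
  shows "(\<lambda>n. cosint (w + 2 * of_nat n) u / cosint (2 * of_nat n) 0) \<longlonglongrightarrow> 1"
proof -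
  let ?S = "{-pi/2<..<pi/2} :: real set"
  define D where "D n = (LINT t:?S|lborel. cos t ^ (2 * n))" for n
  have intD: "set_integrable lborel ?S (\<lambda>t. cos t ^ k)" for k
    unfolding set_integrable_def
    by (rule integrableI_bounded_set_indicator[where B = 1])
       (auto simp: power_abs power_le_one)
  have cosD: "cosint (2 * of_nat n) 0 = of_real (D n)" for n
  proof -
    have "cosint (2 * of_nat n) 0 = (LINT t:?S|lborel. of_real (cos t ^ (2 * n)))"
      unfolding cosint_def
    proof (intro set_lebesgue_integral_cong ballI allI impI)
      fix t :: real assume "t \<in> ?S"
      from cosker_shift_nat[OF this, of 0 n 0]
      show "cosker (2 * of_nat n) 0 t = of_real (cos t ^ (2 * n))"
        by (simp add: cosker_def[of 0])
    qed auto
    then show ?thesis unfolding D_def set_integral_complex_of_real .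
  qed
  \<comment> \<open>Positivity is read off from the Wallis value: a nonnegative integral that is not
    zero.\<close>
  have D0: "D n > 0" for n
  proof -
    have "D n \<ge> 0"
      unfolding D_def set_lebesgue_integral_def by (intro integral_nonneg_AE) auto
    then show ?thesis using cosint_even_nonzero[of n] cosD[of n] by (simp add: less_le)
  qed
  \<comment> \<open>The difference is the integral of \<open>sin t ^ 2\<close> against the weight
    \<open>cos t ^ (2 * n)\<close>. That this second moment is O(1/n) relative to \<open>D n\<close>
    is the concentration used below, and it comes from the recurrence at
    \<open>u = 0\<close>.\<close>
  have DSuc: "D n - D (Suc n) = D n / (2 * real n + 2)" for n
  proof -
    have "of_real ((2 * real n + 1) * (2 * real n + 2) * D n) = (of_real ((2 * real n + 2)\<^sup>2 * D (Suc n)) :: complex)"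
      using cosint_recurrence[of "2 * of_nat n" 0] cosD[of n] cosD[of "Suc n"]
      by (simp add: add_ac)
    then have "(2 * real n + 1) * (2 * real n + 2) * D n = (2 * real n + 2)\<^sup>2 * D (Suc n)"
      by (simp only: of_real_eq_iff)
    then have "(2 * real n + 2) * ((2 * real n + 1) * D n) = (2 * real n + 2) * ((2 * real n + 2) * D (Suc n))"
      by (simp only: power2_eq_square mult_ac)
    then have "(2 * real n + 1) * D n = (2 * real n + 2) * D (Suc n)"
      by (subst (asm) mult_cancel_left) auto
    then show ?thesis by (simp add: field_simps)
  qed
  \<comment> \<open>A Chebyshev argument: near 0 the kernel is within \<open>e\<close> of 1, and
    away from 0 its bounded deviation is at most a multiple of \<open>sin t ^ 2\<close>, whose
    weighted mean tends to 0.\<close>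
  have key: "\<exists>C\<ge>0. \<forall>n. norm (cosint (w + 2 * of_nat n) u / cosint (2 * of_nat n) 0 - 1) \<le> e + C / (2 * real n + 2)"
    if "e > 0" for e
  proof -
    define M where "M = exp (\<bar>Im u\<bar> * (pi/2)) + 1"
    have M: "norm (cosker w u t - 1) \<le> M" if "t \<in> ?S" for t
      using norm_triangle_ineq4[of "cosker w u t" 1] norm_cosker_le[OF assms that, of u] by (simp add: M_def)
    from tendstoD[OF tendsto_cosker_0[of w u] \<open>e > 0\<close>]
    obtain d where d: "d > 0" "\<And>t. t \<noteq> 0 \<Longrightarrow> dist t 0 < d \<Longrightarrow> dist (cosker w u t) 1 < e"
      unfolding eventually_at by auto
    \<comment> \<open>The cap pi/2 keeps \<open>sin d'\<close> positive; with
      \<open>C = M / sin d' ^ 2\<close> the term \<open>C * sin t ^ 2\<close> exceeds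
      \<open>M\<close> as soon as \<open>\<bar>t\<bar>\<close> reaches \<open>d'\<close>.\<close>
    define d' where "d' = min d (pi/2)"
    have d': "0 < d'" "d' \<le> pi/2" "d' \<le> d" using d(1) pi_gt_zero by (auto simp: d'_def)
    have sd: "sin d' > 0" using d' pi_gt_zero by (intro sin_gt_zero) linarith+
    define C where "C = M / sin d' ^ 2"
    have M0: "M > 0" by (simp add: M_def add_pos_pos)
    have C0: "C \<ge> 0" using M0 by (simp add: C_def)
    have ptw: "norm (cosker w u t - 1) \<le> e + C * sin t ^ 2" if t: "t \<in> ?S" for t
    proof (cases "\<bar>t\<bar> < d'")
      case True
      have "norm (cosker w u t - 1) \<le> e"
      proof (cases "t = 0")
        case True then show ?thesis using \<open>e > 0\<close> by (simp add: cosker_def)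
      next
        case False
        then have "dist (cosker w u t) 1 < e" using d(2)[of t] True d'(3) by simp
        then show ?thesis by (simp add: dist_norm)
      qed
      then show ?thesis using C0 by (simp add: add_increasing2)
    next
      case False
      have "sin d' \<le> sin \<bar>t\<bar>"
        using False t d' pi_gt_zero by (intro sin_monotone_2pi_le) (auto simp: abs_if)
      moreover have "sin \<bar>t\<bar> \<le> \<bar>sin t\<bar>" by (simp add: abs_if)
      ultimately have "sin d' ^ 2 \<le> sin t ^ 2"
        unfolding abs_le_square_iff[symmetric] using sd by linarith
      then have "M \<le> C * sin t ^ 2" using sd M0 by (simp add: C_def field_simps)
      then show ?thesis using M[OF t] \<open>e > 0\<close> by linarith
    qed
    have "norm (cosint (w + 2 * of_nat n) u / cosint (2 * of_nat n) 0 - 1) \<le> e + C / (2 * real n + 2)" for n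
    proof -
      have wn: "Re (w + 2 * of_nat n) \<ge> 0" using assms by simp
      have int1: "set_integrable lborel ?S (\<lambda>t. of_real (cos t ^ (2 * n)) * (1::complex))"
        using intD[of "2*n"] unfolding set_integrable_def
        by (simp add: complex_of_real_integrable_eq[symmetric] scaleR_conv_of_real)
      have eqf: "cosker (w + 2 * of_nat n) u t - of_real (cos t ^ (2 * n)) = of_real (cos t ^ (2 * n)) * (cosker w u t - 1)"
        if "t \<in> ?S" for t using cosker_shift_nat[OF that] by (simp add: algebra_simps)
      have "cosint (w + 2 * of_nat n) u - of_real (D n)
          = (LINT t:?S|lborel. cosker (w + 2 * of_nat n) u t - of_real (cos t ^ (2 * n)))"
        unfolding cosint_def D_def set_integral_complex_of_real[symmetric]
        using int1 by (intro set_integral_diff(2)[symmetric] cosker_set_integrable wn) simp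
      also have "norm \<dots> \<le> (LINT t:?S|lborel. norm (cosker (w + 2 * of_nat n) u t - of_real (cos t ^ (2 * n))))"
        using int1 by (intro set_integral_norm_bound set_integral_diff(1) cosker_set_integrable wn) simp
      also have "\<dots> \<le> (LINT t:?S|lborel. (e + C) * cos t ^ (2 * n) - C * cos t ^ (2 * Suc n))"
      proof (rule set_integral_mono)
        show "set_integrable lborel ?S (\<lambda>t. norm (cosker (w + 2 * of_nat n) u t - of_real (cos t ^ (2 * n))))"
          using int1 by (intro set_integrable_norm set_integral_diff(1) cosker_set_integrable wn) simp
        show "set_integrable lborel ?S (\<lambda>t. (e + C) * cos t ^ (2 * n) - C * cos t ^ (2 * Suc n))"
          by (intro set_integral_diff(1) set_integrable_mult_right impI intD)
        fix t :: real assume t: "t \<in> ?S"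
        have "norm (cosker (w + 2 * of_nat n) u t - of_real (cos t ^ (2 * n)))
            = cos t ^ (2 * n) * norm (cosker w u t - 1)"
          unfolding eqf[OF t] norm_mult norm_of_real by simp
        also have "\<dots> \<le> cos t ^ (2 * n) * (e + C * sin t ^ 2)"
          by (intro mult_left_mono ptw t) simp
        also have "\<dots> = (e + C) * cos t ^ (2 * n) - C * cos t ^ (2 * Suc n)"
        proof -
          have "cos t ^ (2 * Suc n) = cos t ^ (2 * n) * (1 - sin t ^ 2)"
            unfolding cos_squared_eq[symmetric] by (simp add: power2_eq_square)
          then show ?thesis by (simp only:) (simp add: algebra_simps)
        qed
        finally show "norm (cosker (w + 2 * of_nat n) u t - of_real (cos t ^ (2 * n)))
             \<le> (e + C) * cos t ^ (2 * n) - C * cos t ^ (2 * Suc n)" .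
      qed
      also have "\<dots> = (e + C) * D n - C * D (Suc n)"
        unfolding D_def
        by (subst set_integral_diff(2); (intro set_integrable_mult_right impI intD)?)
           (simp only: set_integral_mult_right)
      also have "\<dots> = e * D n + C * (D n - D (Suc n))" by (simp add: algebra_simps)
      also have "\<dots> = (e + C / (2 * real n + 2)) * D n" unfolding DSuc by (simp add: algebra_simps)
      finally have fin: "norm (cosint (w + 2 * of_nat n) u - of_real (D n)) \<le> (e + C / (2 * real n + 2)) * D n" .
      have "cosint (w + 2 * of_nat n) u / cosint (2 * of_nat n) 0 - 1
          = (cosint (w + 2 * of_nat n) u - of_real (D n)) / of_real (D n)"
        unfolding cosD using D0[of n] by (simp add: field_simps)
      then have "norm (cosint (w + 2 * of_nat n) u / cosint (2 * of_nat n) 0 - 1)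
          = norm (cosint (w + 2 * of_nat n) u - of_real (D n)) / D n"
        using D0[of n] by (simp only: norm_divide norm_of_real abs_of_pos)
      also have "\<dots> \<le> e + C / (2 * real n + 2)"
        using fin D0[of n] by (simp only: pos_divide_le_eq)
      finally show ?thesis .
    qed
    then show ?thesis by (intro exI[of _ C] conjI allI C0)
  qed
  show ?thesis
  proof (rule tendstoI)
    fix r :: real assume "r > 0"
    obtain C where C: "\<forall>n. norm (cosint (w + 2 * of_nat n) u / cosint (2 * of_nat n) 0 - 1) \<le> r/2 + C / (2 * real n + 2)"
      using key[OF half_gt_zero[OF \<open>r > 0\<close>]] by blast
    have "(\<lambda>n. C / (2 * real n + 2)) \<longlonglongrightarrow> 0" by real_asymp
    then have "\<forall>\<^sub>F n in sequentially. C / (2 * real n + 2) < r/2"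
      by (rule order_tendstoD(2)) (use \<open>r > 0\<close> in simp)
    then show "\<forall>\<^sub>F n in sequentially. dist (cosint (w + 2 * of_nat n) u / cosint (2 * of_nat n) 0) 1 < r"
    proof eventually_elim
      case (elim n)
      then show ?case using spec[OF C, of n] unfolding dist_norm by linarith
    qed
  qed
qed

section \<open>Cauchy's formula and the binomial coefficient\<close>

lemma not_nonpos_Int_if_Re_pos:
  fixes z :: complex
  assumes "Re z > 0"
  shows "z \<notin> \<int>\<^sub>\<le>\<^sub>0"
  using assms by (auto elim!: nonpos_Ints_cases')

text \<open>The iterated recurrence, divided by the Wallis formula, is a relation between Pochhammer
  symbols, and after normalisation each symbol tends to a value of 1/Gamma. Taking limits of
  reciprocals keeps the poles of Gamma harmless on the side where \<open>u\<close> occurs.\<close>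

lemma cosint_eq:
  assumes w: "Re w \<ge> 0"
  shows "cosint w u = of_real (sqrt pi) * Gamma (1 + w / 2) * Gamma ((1 + w) / 2)
           * rGamma (1 + (w + u) / 2) * rGamma (1 + (w - u) / 2)"
proof -
  \<comment> \<open>The shift to \<open>Suc n\<close> matches \<open>rGamma_series z n\<close>,
    whose numerator is \<open>pochhammer z (Suc n)\<close>.\<close>
  define r where "r n = cosint (w + 2 * of_nat (Suc n)) u / cosint (2 * of_nat (Suc n)) 0" for n
  have r: "r \<longlonglongrightarrow> 1"
    unfolding r_def using LIMSEQ_Suc[OF cosint_ratio_tendsto[OF w, of u]] .
  \<comment> \<open>\<open>rGamma_series 1\<close> absorbs the factorial of the Wallis formula. It
    also balances the two sides: with three series on each, the factorials in the denominators
    agree, and so do the powers of \<open>n\<close>, since the arguments add up to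
    \<open>w + 5/2\<close> on both sides.\<close>
  have eq: "cosint w u * rGamma_series (1 + w / 2) n * rGamma_series ((1 + w) / 2) n * rGamma_series 1 n
     = r n * of_real pi * rGamma_series (1/2) n * rGamma_series (1 + (w + u) / 2) n
         * rGamma_series (1 + (w - u) / 2) n" for n
  proof -
    let ?N = "Suc n"
    let ?E = "\<lambda>z :: complex. exp (z * of_real (ln (of_nat n))) :: complex"
    let ?P = "pochhammer (1 + (w + u) / 2) ?N * pochhammer (1 + (w - u) / 2) ?N"
    have "cosint w u * (pochhammer (1 + w / 2) ?N * pochhammer ((1 + w) / 2) ?N) * fact ?N
         = cosint (w + 2 * of_nat ?N) u * ?P * fact ?N"
      unfolding cosint_iterate[OF w] ..
    also have "cosint (w + 2 * of_nat ?N) u = r n * cosint (2 * of_nat ?N) 0"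
      using cosint_even_nonzero[of ?N] by (simp add: r_def del: of_nat_Suc)
    also have "r n * cosint (2 * of_nat ?N) 0 * ?P * fact ?N = r n * (cosint (2 * of_nat ?N) 0 * fact ?N) * ?P"
      by (simp only: mult_ac)
    also have "\<dots> = r n * (of_real pi * pochhammer (1/2) ?N) * ?P"
      unfolding cosint_even ..
    finally have poch: "cosint w u * (pochhammer (1 + w / 2) ?N * pochhammer ((1 + w) / 2) ?N) * fact ?N
        = r n * (of_real pi * pochhammer (1/2) ?N) * ?P" .
    have E: "?E (1 + w / 2) * ?E ((1 + w) / 2) * ?E 1 = ?E (1/2) * ?E (1 + (w + u) / 2) * ?E (1 + (w - u) / 2)"
      unfolding exp_add[symmetric] by (rule arg_cong[of _ _ exp]) (simp add: field_simps)
    have "cosint w u * rGamma_series (1 + w / 2) n * rGamma_series ((1 + w) / 2) n * rGamma_series 1 n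
      = (cosint w u * (pochhammer (1 + w / 2) ?N * pochhammer ((1 + w) / 2) ?N) * fact ?N)
         / (fact n ^ 3 * (?E (1 + w / 2) * ?E ((1 + w) / 2) * ?E 1))"
      unfolding rGamma_series_def by (simp add: pochhammer_fact power3_eq_cube mult_ac del: fact_Suc mult_1_left)
    also have "\<dots> = r n * of_real pi * rGamma_series (1/2) n * rGamma_series (1 + (w + u) / 2) n
         * rGamma_series (1 + (w - u) / 2) n"
      unfolding poch E rGamma_series_def by (simp add: power3_eq_cube mult_ac)
    finally show ?thesis .
  qed
  have "(\<lambda>n. cosint w u * rGamma_series (1 + w / 2) n * rGamma_series ((1 + w) / 2) n * rGamma_series 1 n)
     \<longlonglongrightarrow> cosint w u * rGamma (1 + w / 2) * rGamma ((1 + w) / 2) * rGamma 1"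
    by (intro tendsto_intros)
  moreover have "(\<lambda>n. cosint w u * rGamma_series (1 + w / 2) n * rGamma_series ((1 + w) / 2) n * rGamma_series 1 n)
     \<longlonglongrightarrow> 1 * of_real pi * rGamma (1/2) * rGamma (1 + (w + u) / 2) * rGamma (1 + (w - u) / 2)"
    unfolding eq by (intro tendsto_intros r)
  ultimately have lim: "cosint w u * rGamma (1 + w / 2) * rGamma ((1 + w) / 2)
      = of_real pi * rGamma (1/2) * rGamma (1 + (w + u) / 2) * rGamma (1 + (w - u) / 2)"
    using LIMSEQ_unique by fastforce
  have nz: "rGamma (1 + w / 2) \<noteq> 0" "rGamma ((1 + w) / 2) \<noteq> 0"
    using w by (simp_all add: rGamma_eq_zero_iff not_nonpos_Int_if_Re_pos)
  have half: "of_real pi * rGamma (1/2) = (of_real (sqrt pi) :: complex)"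
  proof -
    have "of_real pi = (of_real (sqrt pi) * of_real (sqrt pi) :: complex)"
      unfolding of_real_mult[symmetric] by simp
    then show ?thesis by (simp add: rGamma_inverse_Gamma Gamma_one_half_complex)
  qed
  have "cosint w u * rGamma (1 + w / 2) * rGamma ((1 + w) / 2)
      = of_real (sqrt pi) * rGamma (1 + (w + u) / 2) * rGamma (1 + (w - u) / 2)"
    unfolding lim half ..
  then show ?thesis using nz by (simp add: Gamma_def field_simps)
qed

text \<open>Legendre duplication at \<open>(1 + w) / 2\<close> merges the two Gamma factors into
  \<open>Gamma (w + 1)\<close> and produces the power of 2; the choice \<open>u = w - 2 * z\<close>
  turns the reciprocal factors into those of the binomial coefficient.\<close>

lemma complex_binomial_eq_cosint:
  assumes "Re w \<ge> 0"
  shows "complex_binomial w z = exp (w * of_real (ln 2)) / of_real pi * cosint w (w - 2 * z)"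
proof -
  have "Gamma ((1 + w) / 2) * Gamma ((1 + w) / 2 + 1 / 2)
      = exp ((1 - 2 * ((1 + w) / 2)) * of_real (ln 2)) * of_real (sqrt pi) * Gamma (2 * ((1 + w) / 2))"
    using assms by (intro Gamma_legendre_duplication not_nonpos_Int_if_Re_pos) (auto simp: field_simps)
  also have "(1 + w) / 2 + 1 / 2 = 1 + w / 2" by (simp add: field_simps)
  also have "1 - 2 * ((1 + w) / 2) = - w" by (simp add: field_simps)
  also have "2 * ((1 + w) / 2) = w + 1" by (simp add: field_simps)
  finally have dup: "Gamma (1 + w / 2) * Gamma ((1 + w) / 2)
      = of_real (sqrt pi) * Gamma (w + 1) / exp (w * of_real (ln 2))"
    by (simp add: exp_minus field_simps)
  have pi: "of_real pi = (of_real (sqrt pi) * of_real (sqrt pi) :: complex)"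
    unfolding of_real_mult[symmetric] by simp
  have args: "1 + (w + (w - 2 * z)) / 2 = w - z + 1" "1 + (w - (w - 2 * z)) / 2 = z + 1"
    by (simp_all add: field_simps)
  have "cosint w (w - 2 * z) = of_real (sqrt pi) * (Gamma (1 + w / 2) * Gamma ((1 + w) / 2))
           * rGamma (w - z + 1) * rGamma (z + 1)"
    unfolding cosint_eq[OF assms] args by (simp only: mult_ac)
  then show ?thesis unfolding dup complex_binomial_def pi by (simp add: field_simps)
qed

section \<open>Holomorphy of parameter integrals\<close>

text \<open>A local bound on \<open>f\<close> alone suffices: by Cauchy's inequality it bounds the
  derivative in \<open>z\<close> on a smaller ball, hence the difference quotients, and dominated
  convergence differentiates under the integral sign.\<close>

lemma holomorphic_on_lebesgue_integral:
  fixes f :: "complex \<Rightarrow> 'b \<Rightarrow> complex"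
  assumes "open U"
    and meas: "\<And>z. z \<in> U \<Longrightarrow> f z \<in> borel_measurable M"
    and hol: "\<And>x. x \<in> space M \<Longrightarrow> (\<lambda>z. f z x) holomorphic_on U"
    and dom: "\<And>z. z \<in> U \<Longrightarrow> \<exists>r>0. \<exists>g. integrable M g \<and>
                 (\<forall>y\<in>ball z r \<inter> U. \<forall>x\<in>space M. norm (f y x) \<le> g x)"
  shows "(\<lambda>z. LINT x|M. f z x) holomorphic_on U"
proof (rule holomorphic_onI)
  fix z assume z: "z \<in> U"
  obtain r1 g where r1: "r1 > 0" and g: "integrable M g"
    and bd1: "\<And>y x. y \<in> ball z r1 \<inter> U \<Longrightarrow> x \<in> space M \<Longrightarrow> norm (f y x) \<le> g x"
    using dom[OF z] by blast
  obtain r2 where r2: "r2 > 0" "ball z r2 \<subseteq> U"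
    using \<open>open U\<close> z openE by blast
  define r where "r = min r1 r2"
  have r: "r > 0" and rU: "ball z r \<subseteq> U" using r1 r2 by (auto simp: r_def)
  have bd: "norm (f y x) \<le> g x" if "y \<in> ball z r" "x \<in> space M" for y x
    using bd1[of y x] that rU by (auto simp: r_def)
  have int: "integrable M (f y)" if "y \<in> ball z r" for y
    using that rU bd by (intro Bochner_Integration.integrable_bound[OF g meas] AE_I2) (force simp: abs_if)+
  define f' where "f' x = deriv (\<lambda>z. f z x) z" for x
  have quot: "norm ((f (z + h) x - f z x) / h) \<le> g x / (r / 2)"
    if h: "norm h < r / 2" and x: "x \<in> space M" for h x
  proof -
    have g0: "g x \<ge> 0" using bd[of z x] x r norm_ge_zero order_trans by (metis centre_in_ball)
    \<comment> \<open>The radius is shared: a disc of radius \<open>r / 2\<close> about a point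
      within \<open>r / 2\<close> of \<open>z\<close> still lies where \<open>g\<close>
      dominates.\<close>
    have derb: "norm (deriv (\<lambda>z. f z x) y) \<le> g x / (r / 2)" if y: "y \<in> ball z (r / 2)" for y
    proof -
      have sub: "cball y (r / 2) \<subseteq> ball z r"
      proof
        fix u assume "u \<in> cball y (r/2)"
        then show "u \<in> ball z r" using y dist_triangle[of z u y] by (simp add: dist_commute)
      qed
      have holc: "(\<lambda>z. f z x) holomorphic_on cball y (r / 2)"
        using holomorphic_on_subset[OF hol[OF x]] sub rU by blast
      have "norm ((deriv ^^ 1) (\<lambda>z. f z x) y) \<le> fact 1 * g x / (r / 2) ^ 1"
      proof (rule Cauchy_inequality)
        show "(\<lambda>z. f z x) holomorphic_on ball y (r / 2)"
          using holc ball_subset_cball holomorphic_on_subset by blast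
        show "continuous_on (cball y (r / 2)) (\<lambda>z. f z x)"
          using holc by (rule holomorphic_on_imp_continuous_on)
        show "0 < r / 2" using r by simp
        fix u assume "norm (y - u) = r / 2"
        then have "u \<in> ball z r" using sub by (auto simp: dist_norm)
        then show "norm (f u x) \<le> g x" using bd x by blast
      qed
      then show ?thesis by simp
    qed
    have "norm (f (z + h) x - f z x) \<le> g x / (r / 2) * norm (z + h - z)"
    proof (rule field_differentiable_bound[where S = "ball z (r / 2)"])
      fix y assume y: "y \<in> ball z (r / 2)"
      then have "y \<in> U" using rU r by auto
      then show "((\<lambda>z. f z x) has_field_derivative deriv (\<lambda>z. f z x) y) (at y within ball z (r / 2))"
        using holomorphic_derivI[OF hol[OF x] \<open>open U\<close>] by blast
      show "norm (deriv (\<lambda>z. f z x) y) \<le> g x / (r / 2)" by (rule derb[OF y])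
    qed (use h r in \<open>auto simp: dist_norm\<close>)
    then show ?thesis
      using g0 r by (cases "h = 0") (auto simp: norm_divide divide_le_eq)
  qed
  have "((\<lambda>h. ((LINT x|M. f (z + h) x) - (LINT x|M. f z x)) / h) \<longlongrightarrow> (LINT x|M. f' x)) (at 0)"
    unfolding tendsto_at_iff_sequentially
  proof (intro allI impI)
    fix X :: "nat \<Rightarrow> complex"
    assume X: "\<forall>i. X i \<in> UNIV - {0}" "X \<longlonglongrightarrow> 0"
    obtain N where N: "\<And>n. n \<ge> N \<Longrightarrow> norm (X n) < r / 2"
      using LIMSEQ_D[OF X(2), of "r/2"] r by auto
    define Y where "Y n = X (n + N)" for n
    have Y: "Y n \<noteq> 0" "norm (Y n) < r / 2" for n using X(1) N by (auto simp: Y_def)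
    have Y0: "filterlim Y (at 0) sequentially"
      unfolding filterlim_at using Y(1) LIMSEQ_ignore_initial_segment[OF X(2), of N] by (auto simp: Y_def[abs_def])
    have zY: "z + Y n \<in> ball z r" for n using Y(2)[of n] r by (auto simp: dist_norm)
    let ?q = "\<lambda>n x. (f (z + Y n) x - f z x) / Y n"
    have q_meas: "?q n \<in> borel_measurable M" for n
      using meas[of z] meas[of "z + Y n"] zY[of n] rU z by (intro borel_measurable_divide borel_measurable_diff) auto
    have q_lim: "(\<lambda>n. ?q n x) \<longlonglongrightarrow> f' x" if "x \<in> space M" for x
    proof -
      have "((\<lambda>z. f z x) has_field_derivative f' x) (at z)"
        unfolding f'_def using holomorphic_derivI[OF hol[OF that] \<open>open U\<close> z] .
      then have "(\<lambda>h. (f (z + h) x - f z x) / h) \<midarrow>0\<rightarrow> f' x" by (simp add: DERIV_def)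
      from filterlim_compose[OF this Y0] show ?thesis .
    qed
    \<comment> \<open>Measurability of the derivative is inherited from the difference quotients as
      their pointwise limit.\<close>
    have f'_meas: "f' \<in> borel_measurable M"
      by (rule borel_measurable_LIMSEQ_metric[OF q_meas q_lim])
    have "(\<lambda>n. LINT x|M. ?q n x) \<longlonglongrightarrow> (LINT x|M. f' x)"
    proof (rule integral_dominated_convergence[OF f'_meas q_meas])
      show "integrable M (\<lambda>x. g x / (r / 2))" using g by simp
      show "AE x in M. (\<lambda>n. ?q n x) \<longlonglongrightarrow> f' x" using q_lim by (intro AE_I2)
      show "AE x in M. norm (?q n x) \<le> g x / (r / 2)" for n
        by (rule AE_I2) (rule quot[OF Y(2)])
    qed
    also have "(\<lambda>n. LINT x|M. ?q n x) = (\<lambda>n. ((LINT x|M. f (z + Y n) x) - (LINT x|M. f z x)) / Y n)"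
    proof
      fix n
      have "(LINT x|M. f (z + Y n) x - f z x) = (LINT x|M. f (z + Y n) x) - (LINT x|M. f z x)"
        using r by (intro Bochner_Integration.integral_diff int zY) simp
      then show "(LINT x|M. ?q n x) = ((LINT x|M. f (z + Y n) x) - (LINT x|M. f z x)) / Y n"
        by (subst integral_divide_zero) simp
    qed
    finally have "(\<lambda>n. ((\<lambda>h. ((LINT x|M. f (z + h) x) - (LINT x|M. f z x)) / h) \<circ> X) (n + N)) \<longlonglongrightarrow> (LINT x|M. f' x)"
      unfolding Y_def o_def .
    then show "((\<lambda>h. ((LINT x|M. f (z + h) x) - (LINT x|M. f z x)) / h) \<circ> X) \<longlonglongrightarrow> (LINT x|M. f' x)"
      by (rule LIMSEQ_offset)
  qed
  then have "((\<lambda>z. LINT x|M. f z x) has_field_derivative (LINT x|M. f' x)) (at z)"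
    by (simp add: DERIV_def)
  then show "(\<lambda>z. LINT x|M. f z x) field_differentiable at z within U"
    using field_differentiable_at_within field_differentiable_def by blast
qed

section \<open>The Fourier transform of sech\<close>

lemma integrable_exp_neg_abs:
  fixes c :: real
  assumes "c > 0"
  shows "integrable lborel (\<lambda>x::real. exp (- c * \<bar>x\<bar>))"
proof -
  have "(\<lambda>x. exp (- c * x)) absolutely_integrable_on {0..}"
    using assms by (intro nonnegative_absolutely_integrable_1 integrable_on_exp_minus_to_infinity) auto
  then have pos: "set_integrable lborel {0..} (\<lambda>x. exp (- c * x))"
    unfolding set_integrable_def by (subst (asm) integrable_completion) auto
  then have "set_integrable lborel {..0} (\<lambda>x. exp (- c * - x))"
    using lborel_integrable_real_affine[of "\<lambda>x. indicator {0..} x *\<^sub>R exp (- c * x)" "-1" 0]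
    by (simp add: set_integrable_def indicator_def)
  then have neg: "set_integrable lborel {..<0} (\<lambda>x. exp (- c * - x))"
    by (rule set_integrable_subset) auto
  have "set_integrable lborel ({0..} \<union> {..<0}) (\<lambda>x. exp (- c * \<bar>x\<bar>))"
  proof (rule set_integrable_Un)
    show "set_integrable lborel {0..} (\<lambda>x. exp (- c * \<bar>x\<bar>))"
      using pos set_integrable_cong[of lborel lborel "{0..}" "{0..}" "\<lambda>x. exp (- c * \<bar>x\<bar>)" "\<lambda>x. exp (- c * x)"]
      by simp
    show "set_integrable lborel {..<0} (\<lambda>x. exp (- c * \<bar>x\<bar>))"
      using neg set_integrable_cong[of lborel lborel "{..<0}" "{..<0}" "\<lambda>x. exp (- c * \<bar>x\<bar>)" "\<lambda>x. exp (- c * - x)"]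
      by simp
  qed auto
  moreover have "{0..} \<union> {..<0} = (UNIV :: real set)" by auto
  ultimately show ?thesis by (simp add: set_integrable_def)
qed

lemma exp_abs_le_cosh: "exp \<bar>x\<bar> / 2 \<le> cosh (x::real)"
  by (cases "x \<ge> 0") (auto simp: cosh_def)

lemma cosh_of_real: "cosh (of_real x :: complex) = of_real (cosh x)"
  by (simp add: cosh_field_def exp_of_real[symmetric] of_real_minus[symmetric] del: of_real_minus)

lemma cosh_measurable [measurable]: "(cosh :: complex \<Rightarrow> complex) \<in> borel_measurable borel"
  by (intro borel_measurable_continuous_onI continuous_intros)

text \<open>Using \<open>b\<close> instead of \<open>\<bar>Re s\<bar>\<close> itself gives one
  dominating function for all \<open>s\<close> near a point of the strip.\<close>

lemma norm_exp_div_cosh_le: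
  assumes "\<bar>Re s\<bar> \<le> b"
  shows "norm (exp (s * of_real x) / cosh (of_real (pi * x))) \<le> 2 * exp (- (pi - b) * \<bar>x\<bar>)"
proof -
  have "Re s * x \<le> b * \<bar>x\<bar>"
    using abs_ge_self[of "Re s * x"] mult_right_mono[OF assms abs_ge_zero[of x]] by (simp add: abs_mult)
  then have 1: "exp (Re s * x) \<le> exp (b * \<bar>x\<bar>)" by simp
  have 2: "exp (pi * \<bar>x\<bar>) / 2 \<le> cosh (pi * x)"
    using exp_abs_le_cosh[of "pi * x"] by (simp add: abs_mult)
  have c: "cosh (pi * x) > 0" by (rule cosh_real_pos)
  have "norm (exp (s * of_real x) / cosh (of_real (pi * x))) = exp (Re s * x) / cosh (pi * x)"
    using c unfolding cosh_of_real norm_divide norm_of_real by simp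
  also have "\<dots> \<le> exp (b * \<bar>x\<bar>) / (exp (pi * \<bar>x\<bar>) / 2)"
    using 1 2 by (intro frac_le) auto
  also have "\<dots> = 2 * exp (- (pi - b) * \<bar>x\<bar>)"
    by (simp add: left_diff_distrib exp_diff)
  finally show ?thesis .
qed

lemma exp_div_cosh_integrable:
  assumes "\<bar>Re s\<bar> < pi"
  shows "integrable lborel (\<lambda>x. exp (s * of_real x) / cosh (of_real (pi * x)) :: complex)"
proof (rule Bochner_Integration.integrable_bound)
  show "integrable lborel (\<lambda>x. 2 * exp (- (pi - \<bar>Re s\<bar>) * \<bar>x\<bar>))"
    using assms by (intro integrable_mult_right integrable_exp_neg_abs) simp
  show "AE x in lborel. norm (exp (s * of_real x) / cosh (of_real (pi * x)))
          \<le> norm (2 * exp (- (pi - \<bar>Re s\<bar>) * \<bar>x\<bar>))"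
  proof (rule AE_I2)
    fix x
    have "norm (exp (s * of_real x) / cosh (of_real (pi * x))) \<le> 2 * exp (- (pi - \<bar>Re s\<bar>) * \<bar>x\<bar>)"
      by (rule norm_exp_div_cosh_le) simp
    also have "\<dots> \<le> norm (2 * exp (- (pi - \<bar>Re s\<bar>) * \<bar>x\<bar>))"
      unfolding real_norm_def by (rule abs_ge_self)
    finally show "norm (exp (s * of_real x) / cosh (of_real (pi * x)))
          \<le> norm (2 * exp (- (pi - \<bar>Re s\<bar>) * \<bar>x\<bar>))" .
  qed
qed measurable

text \<open>Substituting \<open>t = 1 / (1 + exp (- 2 * pi * x))\<close> gives a Beta integral.\<close>

lemma exp_div_cosh_integral_real:
  fixes s :: real
  assumes "\<bar>s\<bar> < pi"
  shows "(LINT x|lborel. exp (s * x) / cosh (pi * x)) = 1 / cos (s / 2)"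
proof -
  \<comment> \<open>With g = exp (pi x) / (2 cosh (pi x)), the product g ^ a * (1 - g) ^ b is exp
    (pi (a - b) x) / (2 cosh (pi x)) ^ (a + b). The exponents solve a + b = 1 and pi (a - b) =
    s.\<close>
  define a where "a = 1/2 + s / (2 * pi)"
  define b where "b = 1/2 - s / (2 * pi)"
  have ab: "a > 0" "b > 0" "a + b = 1" using assms by (auto simp: a_def b_def field_simps abs_if split: if_splits)
  define g where "g x = exp (pi * x) / (2 * cosh (pi * x))" for x :: real
  define g' where "g' x = 2 * pi * g x * (1 - g x)" for x :: real
  define f where "f t = t powr (a - 1) * (1 - t) powr (b - 1) / pi" for t :: real
  have c: "cosh (pi * x) > 0" for x :: real by (rule cosh_real_pos)
  have g1: "1 - g x = exp (- pi * x) / (2 * cosh (pi * x))" for x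
    using c[of x] by (simp add: g_def field_simps) (simp add: cosh_def field_simps)
  have gpos: "g x > 0" "1 - g x > 0" for x unfolding g1 unfolding g_def by simp_all
  have fg: "f (g x) * g' x = exp (s * x) / cosh (pi * x)" for x
  proof -
    have "f (g x) * g' x = 2 * (g x powr a * (1 - g x) powr b)"
    proof -
      have "p powr (a - 1) * q powr (b - 1) / pi * (2 * pi * p * q) = 2 * (p powr a * q powr b)"
        if "p > 0" "q > 0" for p q using that by (simp add: powr_diff)
      from this[OF gpos] show ?thesis unfolding f_def g'_def .
    qed
    also have "g x powr a = exp (pi * x * a) / (2 * cosh (pi * x)) powr a"
      unfolding g_def using c[of x] by (subst powr_divide) (auto simp: powr_def mult_ac)
    also have "(1 - g x) powr b = exp (- pi * x * b) / (2 * cosh (pi * x)) powr b"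
      unfolding g1 using c[of x] by (subst powr_divide) (auto simp: powr_def mult_ac)
    also have "exp (pi * x * a) / (2 * cosh (pi * x)) powr a * (exp (- pi * x * b) / (2 * cosh (pi * x)) powr b)
        = exp (pi * x * a + - pi * x * b) / (2 * cosh (pi * x)) powr (a + b)"
      by (simp only: exp_add powr_add times_divide_times_eq)
    also have "pi * x * a + - pi * x * b = s * x" by (simp add: a_def b_def field_simps)
    also have "(2 * cosh (pi * x)) powr (a + b) = 2 * cosh (pi * x)" using c[of x] ab(3) by simp
    finally show ?thesis by simp
  qed
  have g_alt: "g x = 1 / (1 + exp (- 2 * pi * x))" for x
  proof -
    have "2 * cosh (pi * x) = exp (pi * x) * (1 + exp (- 2 * pi * x))"
      by (simp add: cosh_def algebra_simps exp_add[symmetric])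
    then show ?thesis unfolding g_def by simp
  qed
  have "(LBINT x=-\<infinity>..\<infinity>. f (g x) * g' x) = (LBINT x=0..1. f x)"
  proof (rule interval_integral_substitution_nonneg(2)[symmetric, where g' = g'])
    show "DERIV g x :> g' x" for x
    proof -
      have "((\<lambda>x. 1 / (1 + exp (- 2 * pi * x))) has_real_derivative
              2 * pi * exp (- 2 * pi * x) / (1 + exp (- 2 * pi * x))\<^sup>2) (at x)"
        by (auto intro!: derivative_eq_intros simp: add_pos_pos less_imp_neq[symmetric] power2_eq_square)
      also have "2 * pi * exp (- 2 * pi * x) / (1 + exp (- 2 * pi * x))\<^sup>2 = g' x"
        by (simp add: g'_def g_alt field_simps power2_eq_square add_pos_pos less_imp_neq[symmetric])
      finally show ?thesis unfolding g_alt[abs_def] .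
    qed
    then have contg: "isCont g x" for x by (rule DERIV_isCont)
    show "isCont g' x" for x unfolding g'_def by (intro continuous_intros contg)
    show "isCont f (g x)" for x
      unfolding f_def using gpos[of x] by (intro continuous_intros) auto
    show "0 \<le> f (g x)" for x by (simp add: f_def)
    show "0 \<le> g' x" for x using gpos[of x] by (simp add: g'_def)
    have "(g \<longlongrightarrow> 0) at_bot" unfolding g_alt[abs_def] by real_asymp
    then show "((ereal \<circ> g \<circ> real_of_ereal) \<longlongrightarrow> 0) (at_right (-\<infinity>))"
      by (simp add: ereal_tendsto_simps zero_ereal_def)
    have "(g \<longlongrightarrow> 1) at_top" unfolding g_alt[abs_def] by real_asymp
    then show "((ereal \<circ> g \<circ> real_of_ereal) \<longlongrightarrow> 1) (at_left \<infinity>)"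
      by (simp add: ereal_tendsto_simps one_ereal_def)
    \<comment> \<open>The substitution rule presupposes integrability on the line side; it is the
      real part of the complex statement at a real \<open>s\<close>.\<close>
    have "integrable lborel (\<lambda>x. Re (exp (of_real s * of_real x) / cosh (of_real (pi * x))))"
      using assms by (intro integrable_Re exp_div_cosh_integrable) simp
    also have "(\<lambda>x. Re (exp (of_real s * of_real x) / cosh (of_real (pi * x)))) = (\<lambda>x. f (g x) * g' x)"
      unfolding fg of_real_mult[symmetric] exp_of_real cosh_of_real of_real_divide[symmetric] by simp
    finally show "set_integrable lborel (einterval (-\<infinity>) \<infinity>) (\<lambda>x. f (g x) * g' x)"
      by (simp add: set_integrable_def)
  qed auto
  also have "(LBINT x=0..1. f x) = (LBINT x:{0<..<1}. f x)"
    by (simp add: interval_lebesgue_integral_def zero_ereal_def one_ereal_def)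
  also have "\<dots> = integral {0<..<1} f"
  proof (rule set_borel_integral_eq_integral)
    have "set_integrable lborel {0..1} (\<lambda>t. t powr (a - 1) * (1 - t) powr (b - 1))"
      using ab by (intro integrable_Beta)
    then show "set_integrable lborel {0<..<1} f"
      unfolding f_def by (intro set_integrable_divide) (auto elim: set_integrable_subset)
  qed
  also have "\<dots> = integral {0..1} f" by (simp add: integral_open_interval_real)
  also have "\<dots> = Beta a b / pi"
    using has_integral_divide[OF has_integral_Beta_real[OF ab(1,2)], of pi] unfolding f_def
    by (rule integral_unique)
  \<comment> \<open>Since \<open>a + b = 1\<close>, this is Euler's reflection formula.\<close>
  also have "Beta a b = pi / sin (pi * a)"
  proof -
    have b: "b = 1 - a" using ab(3) by simp
    have "of_real (Gamma a * Gamma b) = (Gamma (of_real a) * Gamma (1 - of_real a) :: complex)"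
      unfolding b by (simp add: Gamma_complex_of_real[symmetric] of_real_diff)
    also have "\<dots> = of_real (pi / sin (pi * a))"
      unfolding Gamma_reflection_complex by (simp add: sin_of_real[symmetric])
    finally have "Gamma a * Gamma b = pi / sin (pi * a)" by (simp only: of_real_eq_iff)
    then show ?thesis by (simp add: Beta_def ab(3))
  qed
  also have "sin (pi * a) = cos (s / 2)"
    by (simp add: a_def distrib_left sin_add)
  finally show ?thesis
    unfolding fg by (simp add: interval_lebesgue_integral_def set_lebesgue_integral_def)
qed

text \<open>The Fourier transform needs imaginary \<open>s\<close>, while the Beta substitution is
  real. Both sides are holomorphic on the strip, since the zeros of \<open>cos (s / 2)\<close> are
  odd multiples of pi and lie outside it, and they agree on the real segment, which accumulates at
  0.\<close>

lemma exp_div_cosh_integral: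
  assumes s: "\<bar>Re s\<bar> < pi"
  shows "(LINT x|lborel. exp (s * of_real x) / cosh (of_real (pi * x))) = 1 / cos (s / 2)"
proof -
  define S where "S = {s. \<bar>Re s\<bar> < pi}"
  have S: "S = {s. Re s < pi} \<inter> {s. Re s > - pi}" by (auto simp: S_def)
  have oS: "open S" unfolding S by (intro open_Int open_halfspace_Re_lt open_halfspace_Re_gt)
  have cS: "connected S"
    unfolding S by (intro convex_connected convex_Int convex_halfspace_Re_lt convex_halfspace_Re_gt)
  let ?F = "\<lambda>s. LINT x|lborel. exp (s * of_real x) / cosh (of_real (pi * x)) :: complex"
  have cosh0: "cosh (of_real (pi * x)) \<noteq> (0 :: complex)" for x
    unfolding cosh_of_real by simp
  have holF: "?F holomorphic_on S"
  proof (rule holomorphic_on_lebesgue_integral[OF oS])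
    show "(\<lambda>x. exp (s * of_real x) / cosh (of_real (pi * x))) \<in> borel_measurable lborel" for s :: complex
      by measurable
    show "(\<lambda>s. exp (s * of_real x) / cosh (of_real (pi * x))) holomorphic_on S" for x
      using cosh0 by (intro holomorphic_intros)
    fix z assume "z \<in> S"
    then have zpi: "\<bar>Re z\<bar> < pi" by (simp add: S_def)
    define r where "r = (pi - \<bar>Re z\<bar>) / 2"
    have r: "r > 0" using zpi by (simp add: r_def)
    show "\<exists>r>0. \<exists>g. integrable lborel g \<and> (\<forall>y\<in>ball z r \<inter> S. \<forall>x\<in>space lborel.
            norm (exp (y * of_real x) / cosh (of_real (pi * x))) \<le> g x)"
    proof (rule exI[of _ r], intro conjI r exI[of _ "\<lambda>x. 2 * exp (- (pi - (\<bar>Re z\<bar> + r)) * \<bar>x\<bar>)"] ballI)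
      show "integrable lborel (\<lambda>x. 2 * exp (- (pi - (\<bar>Re z\<bar> + r)) * \<bar>x\<bar>))"
        using r by (intro integrable_mult_right integrable_exp_neg_abs) (simp add: r_def field_simps)
      fix y and x :: real assume "y \<in> ball z r \<inter> S"
      then have "\<bar>Re (z - y)\<bar> \<le> r" using abs_Re_le_cmod[of "z - y"] by (simp add: dist_norm)
      then have "\<bar>Re y\<bar> \<le> \<bar>Re z\<bar> + r" by (simp add: abs_le_iff)  linarith
      then show "norm (exp (y * of_real x) / cosh (of_real (pi * x))) \<le> 2 * exp (- (pi - (\<bar>Re z\<bar> + r)) * \<bar>x\<bar>)"
        by (rule norm_exp_div_cosh_le)
    qed
  qed
  have cos0: "cos (z / 2) \<noteq> 0" if "z \<in> S" for z
  proof
    assume "cos (z / 2) = 0"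
    then obtain n :: int where n: "z / 2 = of_real (of_int n * pi) + of_real pi / 2"
      unfolding cos_eq_0 by blast
    define m where "m = 2 * n + 1"
    have "z = 2 * (of_real (of_int n * pi) + of_real pi / 2)" unfolding n[symmetric] by simp
    then have "z = of_real (of_int m * pi)" by (simp add: m_def algebra_simps)
    then have "\<bar>Re z\<bar> = \<bar>of_int m\<bar> * pi" by (simp add: abs_mult)
    moreover have "\<bar>real_of_int m\<bar> \<ge> 1" 
    proof -
      have "m \<noteq> 0" unfolding m_def by presburger
      then have "1 \<le> \<bar>m\<bar>" by linarith
      then show ?thesis by (metis of_int_1_le_iff of_int_abs)
    qed
    ultimately have "\<bar>Re z\<bar> \<ge> pi" by simp
    with that show False by (simp add: S_def)
  qed
  have "?F s - 1 / cos (s / 2) = 0"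
  proof (rule analytic_continuation[of "\<lambda>s. ?F s - 1 / cos (s / 2)" S "of_real ` {-pi<..<pi}" 0])
    show "(\<lambda>s. ?F s - 1 / cos (s / 2)) holomorphic_on S"
      using cos0 by (intro holomorphic_intros holF) auto
    show "of_real ` {-pi<..<pi} \<subseteq> S" by (auto simp: S_def)
    show "(0::complex) islimpt of_real ` {-pi<..<pi}"
      unfolding islimpt_approachable
    proof (intro allI impI)
      fix e :: real assume "e > 0"
      define d where "d = min e pi / 2"
      have "d > 0" "d < e" "d < pi" using \<open>e > 0\<close> pi_gt_zero by (auto simp: d_def min_def)
      then show "\<exists>x'\<in>of_real ` {-pi<..<pi}. x' \<noteq> (0::complex) \<and> dist x' 0 < e"
        by (intro bexI[of _ "of_real d"]) auto
    qed
    fix z :: complex assume "z \<in> of_real ` {-pi<..<pi}"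
    then obtain u where u: "z = of_real u" "\<bar>u\<bar> < pi" by auto
    have "?F z = (LINT x|lborel. of_real (exp (u * x) / cosh (pi * x)))"
      unfolding u of_real_mult[symmetric] exp_of_real cosh_of_real of_real_divide[symmetric] ..
    also have "\<dots> = of_real (1 / cos (u / 2))"
      unfolding exp_div_cosh_integral_real[OF u(2), symmetric] by (rule integral_complex_of_real)
    also have "\<dots> = 1 / cos (z / 2)" unfolding u by (simp add: cos_of_real[symmetric])
    finally show "?F z - 1 / cos (z / 2) = 0" by simp
  qed (use s oS cS in \<open>auto simp: S_def\<close>)
  then show ?thesis by simp
qed

text \<open>After scaling by \<open>a\<close> the exponent is \<open>s = - 2 * \<i> * a * t\<close>,
  where \<open>cos (s / 2)\<close> becomes \<open>cosh (a * t)\<close>.\<close>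

lemma sech_fourier:
  fixes a t :: real
  assumes "a > 0"
  shows "(LINT x|lborel. exp (- 2 * \<i> * of_real (x * t)) * sech (of_real (pi * x / a)))
       = of_real a * sech (of_real (a * t))"
proof -
  have "(LINT x|lborel. exp (- 2 * \<i> * of_real (x * t)) * sech (of_real (pi * x / a)))
     = \<bar>a\<bar> *\<^sub>R (LINT x|lborel. exp (- 2 * \<i> * of_real ((0 + a * x) * t)) * sech (of_real (pi * (0 + a * x) / a)))"
    using assms by (intro lborel_integral_real_affine) simp
  also have "(\<lambda>x. exp (- 2 * \<i> * of_real ((0 + a * x) * t)) * sech (of_real (pi * (0 + a * x) / a)))
     = (\<lambda>x. exp ((- 2 * \<i> * of_real (a * t)) * of_real x) / cosh (of_real (pi * x)))"
    using assms by (auto simp: sech_def mult_ac)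
  also have "(LINT x|lborel. exp ((- 2 * \<i> * of_real (a * t)) * of_real x) / cosh (of_real (pi * x)))
     = 1 / cos ((- 2 * \<i> * of_real (a * t)) / 2)"
    by (rule exp_div_cosh_integral) simp
  also have "cos ((- 2 * \<i> * of_real (a * t)) / 2) = cosh (of_real (a * t))"
    by (simp add: cosh_conv_cos)
  finally show ?thesis using assms by (simp add: sech_def scaleR_conv_of_real)
qed

section \<open>Locally uniform bounds for the integrand\<close>

lemma complex_binomial_plus1:
  assumes "Im w \<noteq> 0"
  shows "complex_binomial w z = complex_binomial (w + 1) z * ((w + 1 - z) / (w + 1))"
proof -
  have nz: "w + 1 \<noteq> 0" using assms by (auto simp: complex_eq_iff)
  have "w + 1 \<notin> \<int>\<^sub>\<le>\<^sub>0" using assms by (auto elim!: nonpos_Ints_cases' simp: complex_eq_iff)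
  then have "Gamma (w + 1 + 1) = (w + 1) * Gamma (w + 1)" by (rule Gamma_plus1)
  moreover have "rGamma (w - z + 1) = (w - z + 1) * rGamma (w - z + 1 + 1)"
    by (rule rGamma_plus1[symmetric])
  moreover have "w + 1 - z = w - z + 1" by simp
  ultimately show ?thesis
    unfolding complex_binomial_def using nz by simp
qed

text \<open>After \<open>n\<close> unit shifts the exponent lies in the half-plane where the bound
  on \<open>cosint\<close> is uniform in x. Each shift costs one factor
  \<open>1 + \<bar>x\<bar> / Im w\<close>, because the shifts leave \<open>Im w\<close> unchanged
  and the norm of \<open>w + 1\<close> is at least \<open>Im w\<close>.\<close>

lemma norm_complex_binomial_le:
  fixes x :: real
  assumes "Im w > 0" "Re w + real n \<ge> 0"
  shows "norm (complex_binomial w (of_real x))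
           \<le> exp ((Re w + real n) * ln 2 + Im w * (pi / 2)) * (1 + \<bar>x\<bar> / Im w) ^ n"
  using assms
proof (induction n arbitrary: w)
  case 0
  have "norm (complex_binomial w (of_real x)) = exp (Re w * ln 2) / pi * norm (cosint w (w - 2 * of_real x))"
    using 0 by (simp add: complex_binomial_eq_cosint norm_mult norm_divide)
  also have "\<dots> \<le> exp (Re w * ln 2) / pi * (pi * exp (\<bar>Im (w - 2 * of_real x)\<bar> * (pi / 2)))"
    using 0 by (intro mult_left_mono norm_cosint_le) auto
  also have "\<dots> = exp (Re w * ln 2 + Im w * (pi / 2))"
    using 0 by (simp add: exp_add)
  finally show ?case by simp
next
  case (Suc n)
  have nz: "w + 1 \<noteq> 0" using Suc.prems by (auto simp: complex_eq_iff)
  have le: "Im w \<le> norm (w + 1)" using abs_Im_le_cmod[of "w + 1"] Suc.prems by simp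
  have "(w + 1 - of_real x) / (w + 1) = 1 - of_real x / (w + 1)"
    using nz by (simp add: diff_divide_distrib)
  then have "norm ((w + 1 - of_real x) / (w + 1)) \<le> 1 + \<bar>x\<bar> / norm (w + 1)"
    using norm_triangle_ineq4[of 1 "of_real x / (w + 1)"] by (simp add: norm_divide)
  also have "\<dots> \<le> 1 + \<bar>x\<bar> / Im w"
    using le Suc.prems by (intro add_left_mono divide_left_mono) (auto intro!: mult_pos_pos)
  finally have factor: "norm ((w + 1 - of_real x) / (w + 1)) \<le> 1 + \<bar>x\<bar> / Im w" .
  have IH: "norm (complex_binomial (w + 1) (of_real x))
     \<le> exp ((Re (w + 1) + real n) * ln 2 + Im (w + 1) * (pi / 2)) * (1 + \<bar>x\<bar> / Im (w + 1)) ^ n"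
    by (rule Suc.IH) (use Suc.prems in auto)
  have "norm (complex_binomial w (of_real x))
      = norm (complex_binomial (w + 1) (of_real x)) * norm ((w + 1 - of_real x) / (w + 1))"
    unfolding norm_mult[symmetric] using Suc.prems by (subst complex_binomial_plus1) auto
  also have "\<dots> \<le> exp ((Re (w + 1) + real n) * ln 2 + Im (w + 1) * (pi / 2)) * (1 + \<bar>x\<bar> / Im (w + 1)) ^ n
        * (1 + \<bar>x\<bar> / Im w)"
    using Suc.prems by (intro mult_mono IH factor) auto
  also have "\<dots> = exp ((Re w + real (Suc n)) * ln 2 + Im w * (pi / 2)) * (1 + \<bar>x\<bar> / Im w) ^ Suc n"
    by (simp add: add_ac)
  finally show ?case .
qed

text \<open>Half of the exponential decay is spent on the polynomial factor.\<close>

lemma power_times_exp_bounded: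
  fixes c d :: real
  assumes "c > 0" "d > 0"
  obtains C where "C \<ge> 0" "\<And>x::real. (1 + \<bar>x\<bar> / d) ^ n * exp (- c * \<bar>x\<bar>) \<le> C * exp (- (c / 2) * \<bar>x\<bar>)"
proof
  \<comment> \<open>From \<open>k * y \<le> exp (k * y)\<close> the n-th power is at most
    \<open>exp (n * k * y)\<close>. This \<open>k\<close> makes
    \<open>n * k \<le> c * d / 2\<close>, so the exponent grows no faster than
    \<open>c / 2 * \<bar>x\<bar>\<close>; \<open>n + 1\<close> in the denominator covers
    \<open>n = 0\<close>.\<close>
  define k where "k = c * d / (2 * (real n + 1))"
  have k: "k > 0" using assms by (simp add: k_def)
  have nk: "real n * k \<le> c * d / 2"
    using assms by (simp add: k_def field_simps)
  let ?C = "exp (c * d / 2) / k ^ n"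
  show "?C \<ge> 0" using k by simp
  fix x :: real
  define y where "y = 1 + \<bar>x\<bar> / d"
  have y: "y \<ge> 0" using assms by (simp add: y_def)
  have "k * y \<le> exp (k * y)" using exp_ge_add_one_self[of "k * y"] by linarith
  then have "(k * y) ^ n \<le> exp (k * y) ^ n" using k y by (intro power_mono) auto
  also have "\<dots> = exp (real n * k * y)" by (simp add: exp_of_nat_mult[symmetric] mult_ac)
  also have "\<dots> \<le> exp (c * d / 2 * y)" using mult_right_mono[OF nk y] by simp
  also have "c * d / 2 * y = c * d / 2 + c / 2 * \<bar>x\<bar>" using assms by (simp add: y_def field_simps)
  finally have "k ^ n * y ^ n \<le> exp (c * d / 2) * exp (c / 2 * \<bar>x\<bar>)"
    by (simp only: power_mult_distrib exp_add)
  then have "y ^ n \<le> ?C * exp (c / 2 * \<bar>x\<bar>)"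
    using k by (simp add: field_simps)
  then have "y ^ n * exp (- c * \<bar>x\<bar>) \<le> ?C * exp (c / 2 * \<bar>x\<bar>) * exp (- c * \<bar>x\<bar>)"
    by (intro mult_right_mono) auto
  also have "\<dots> = ?C * exp (c / 2 * \<bar>x\<bar> + - c * \<bar>x\<bar>)" by (simp only: exp_add mult_ac)
  also have "c / 2 * \<bar>x\<bar> + - c * \<bar>x\<bar> = - (c / 2) * \<bar>x\<bar>" by simp
  finally show "(1 + \<bar>x\<bar> / d) ^ n * exp (- c * \<bar>x\<bar>) \<le> ?C * exp (- (c / 2) * \<bar>x\<bar>)"
    by (simp add: y_def)
qed

text \<open>The reverse triangle inequality for exp z + exp (- z); using it for both
  \<open>z\<close> and \<open>- z\<close> gives the absolute value.\<close>

lemma sinh_le_norm_cosh: "sinh \<bar>Re z\<bar> \<le> norm (cosh z)"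
proof -
  have *: "sinh (Re z) \<le> norm (cosh z)" for z
  proof -
    have "sinh (Re z) = (norm (exp z) - norm (exp (- z))) / 2"
      by (simp add: sinh_field_def)
    also have "\<dots> \<le> norm (exp z + exp (- z)) / 2"
      by (intro divide_right_mono norm_diff_ineq) simp
    also have "\<dots> = norm (cosh z)" by (simp add: cosh_field_def norm_divide)
    finally show ?thesis .
  qed
  show ?thesis using *[of z] *[of "-z"] by (auto simp: abs_if)
qed

lemma Re_of_real_div: "Re (of_real x / z) = x * Re z / (norm z)\<^sup>2"
  by (simp add: Re_divide cmod_power2)

lemma cosh_of_real_div_nonzero:
  fixes x :: real
  assumes "Re z > 0"
  shows "cosh (of_real x / z) \<noteq> 0"
proof (cases "x = 0")
  case False
  have "z \<noteq> 0" using assms by auto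
  then have "Re (of_real x / z) \<noteq> 0" using False assms by (simp add: Re_of_real_div)
  then have "0 < sinh \<bar>Re (of_real x / z)\<bar>" by simp
  also have "\<dots> \<le> norm (cosh (of_real x / z))" by (rule sinh_le_norm_cosh)
  finally show ?thesis by auto
qed simp

text \<open>The real part of pi x / z is pi x times Re z / |z|^2, and the minimum of this quotient
  over \<open>K\<close> gives a common rate. The lower bound of cosh by sinh degenerates at x = 0,
  so \<open>\<bar>x\<bar> \<le> 1\<close> is treated separately, by compactness.\<close>

lemma norm_sech_le:
  assumes "K \<subseteq> {z. Re z > 0}" "compact K"
  obtains C c where "c > 0" "C \<ge> 0"
    "\<And>z x::real. z \<in> K \<Longrightarrow> norm (sech (of_real pi * of_real x / z)) \<le> C * exp (- c * \<bar>x\<bar>)"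
proof (cases "K = {}")
  case True
  then show ?thesis using that[of 1 1] by auto
next
  case False
  have K0: "z \<noteq> 0" if "z \<in> K" for z using assms(1) that by auto
  have "continuous_on K (\<lambda>z. Re z / (norm z)\<^sup>2)"
    using K0 by (intro continuous_intros) auto
  from continuous_attains_inf[OF assms(2) False this]
  obtain z0 where z0: "z0 \<in> K" "\<And>z. z \<in> K \<Longrightarrow> Re z0 / (norm z0)\<^sup>2 \<le> Re z / (norm z)\<^sup>2" by blast
  define c where "c = pi * (Re z0 / (norm z0)\<^sup>2)"
  have c: "c > 0" using z0(1) assms(1) K0[OF z0(1)] by (auto simp: c_def)
  have "compact ((\<lambda>(z, x). sech (of_real pi * of_real x / z)) ` (K \<times> {-1..1::real}))"
    unfolding sech_def case_prod_unfold
  proof (intro compact_continuous_image compact_Times assms(2) compact_Icc continuous_intros)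
    show "\<forall>p\<in>K \<times> {-1..1}. cosh (of_real pi * of_real (snd p) / fst p) \<noteq> (0::complex)"
    proof
      fix p :: "complex \<times> real" assume "p \<in> K \<times> {-1..1}"
      then have "Re (fst p) > 0" using assms(1) by auto
      from cosh_of_real_div_nonzero[OF this, of "pi * snd p"]
      show "cosh (of_real pi * of_real (snd p) / fst p) \<noteq> (0::complex)" by simp
    qed
  qed (use K0 in auto)
  then obtain B where B0: "B > 0"
    and B: "\<And>u. u \<in> (\<lambda>(z, x). sech (of_real pi * of_real x / z)) ` (K \<times> {-1..1::real}) \<Longrightarrow> norm u \<le> B"
    using compact_imp_bounded bounded_pos by metis
  \<comment> \<open>Since 2 sinh y = exp y (1 - exp (- 2 y)), this is the constant with sinh y >=
    exp y / D for all y >= c.\<close>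
  define D where "D = 2 / (1 - exp (- 2 * c))"
  have e: "exp (- 2 * c) < 1" using c by simp
  have D: "D > 0" using e by (simp add: D_def)
  \<comment> \<open>The factor \<open>exp c\<close> offsets the decay
    \<open>exp (- c * \<bar>x\<bar>)\<close> on \<open>\<bar>x\<bar> \<le> 1\<close>, where only the
    bound \<open>B\<close> is available.\<close>
  show ?thesis
  proof (rule that[OF c, of "B * exp c + D"])
    show "B * exp c + D \<ge> 0" using B0 D by simp
    fix z and x :: real assume z: "z \<in> K"
    show "norm (sech (of_real pi * of_real x / z)) \<le> (B * exp c + D) * exp (- c * \<bar>x\<bar>)"
    proof (cases "\<bar>x\<bar> \<le> 1")
      case True
      have "(z, x) \<in> K \<times> {-1..1}" using z True by auto
      from B[OF imageI[OF this]] have "norm (sech (of_real pi * of_real x / z)) \<le> B * 1" by simp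
      also have "\<dots> \<le> B * exp (c - c * \<bar>x\<bar>)" using True B0 c by (intro mult_left_mono) auto
      also have "\<dots> = B * exp c * exp (- c * \<bar>x\<bar>)" by (simp add: exp_diff exp_minus field_simps)
      also have "\<dots> \<le> (B * exp c + D) * exp (- c * \<bar>x\<bar>)" using D by (intro mult_right_mono) auto
      finally show ?thesis .
    next
      case False
      let ?z = "of_real (pi * x) / z"
      have "\<bar>Re ?z\<bar> = pi * (Re z / (norm z)\<^sup>2) * \<bar>x\<bar>"
      proof -
        have "Re z > 0" using assms(1) z by auto
        then show ?thesis unfolding Re_of_real_div by (simp add: abs_mult)
      qed
      also have "\<dots> \<ge> c * \<bar>x\<bar>"
        unfolding c_def using z0(2)[OF z] by (intro mult_right_mono mult_left_mono) auto
      finally have "sinh (c * \<bar>x\<bar>) \<le> sinh \<bar>Re ?z\<bar>" by (simp only: sinh_real_le_iff)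
      also have "\<dots> \<le> norm (cosh ?z)" by (rule sinh_le_norm_cosh)
      finally have 1: "sinh (c * \<bar>x\<bar>) \<le> norm (cosh ?z)" .
      have "exp (- 2 * (c * \<bar>x\<bar>)) \<le> exp (- 2 * c)" using False c by simp
      then have "exp (c * \<bar>x\<bar>) * (1 - exp (- 2 * c)) \<le> exp (c * \<bar>x\<bar>) * (1 - exp (- 2 * (c * \<bar>x\<bar>)))"
        by (intro mult_left_mono) auto
      also have "\<dots> = 2 * sinh (c * \<bar>x\<bar>)"
        by (simp add: sinh_field_def algebra_simps exp_add[symmetric])
      finally have 2: "exp (c * \<bar>x\<bar>) / D \<le> sinh (c * \<bar>x\<bar>)" by (simp add: D_def)
      have "0 < exp (c * \<bar>x\<bar>) / D" using D by simp
      moreover have "exp (c * \<bar>x\<bar>) / D \<le> norm (cosh ?z)" using 1 2 by linarith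
      ultimately have "1 / norm (cosh ?z) \<le> 1 / (exp (c * \<bar>x\<bar>) / D)"
        by (intro divide_left_mono mult_pos_pos) linarith+
      then have "norm (sech ?z) \<le> D * exp (- c * \<bar>x\<bar>)"
        by (simp add: sech_def norm_divide exp_minus field_simps)
      also have "\<dots> \<le> (B * exp c + D) * exp (- c * \<bar>x\<bar>)"
        using B0 by (intro mult_right_mono) auto
      finally show ?thesis by simp
    qed
  qed
qed

text \<open>A single bound for a whole ball of parameters is what differentiation under the integral
  needs; at the centre it also gives integrability.\<close>

lemma binomial_sech_dominated:
  assumes "Re z > 0"
  obtains r g where "r > 0" "integrable lborel g" "ball z r \<subseteq> {z. Re z > 0}"
    "\<And>y x::real. y \<in> ball z r \<Longrightarrow>
       norm (complex_binomial (\<i> * y) (of_real x) * sech (of_real pi * of_real x / y)) \<le> g x"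
proof -
  \<comment> \<open>Half the distance to the imaginary axis: on the closed ball, which is compact,
    \<open>Re y = Im (\<i> * y)\<close> stays at least \<open>r\<close>.\<close>
  define r where "r = Re z / 2"
  have r: "r > 0" using assms by (simp add: r_def)
  have Re: "r \<le> Re y" if "y \<in> cball z r" for y
    using that abs_Re_le_cmod[of "z - y"] by (simp add: dist_norm r_def)
  have nrm: "norm y \<le> norm z + r" if "y \<in> cball z r" for y
    using that norm_triangle_ineq2[of y z] by (simp add: dist_norm norm_minus_commute)
  have sub: "cball z r \<subseteq> {z. Re z > 0}" using Re r by force
  from norm_sech_le[OF sub compact_cball] obtain C c where c: "c > 0" "C \<ge> 0"
    and sech: "\<And>y x. y \<in> cball z r \<Longrightarrow> norm (sech (of_real pi * of_real x / y)) \<le> C * exp (- c * \<bar>x\<bar>)"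
    by metis
  define R where "R = norm z + r"
  have R: "R \<ge> 0" using r by (simp add: R_def)
  \<comment> \<open>The real part of \<open>\<i> * y\<close> is \<open>- Im y\<close>, at least
    \<open>- R\<close>, so this many unit shifts suffice for every \<open>y\<close> in the
    ball.\<close>
  define n where "n = nat \<lceil>R\<rceil>"
  have n: "real n \<ge> R" unfolding n_def by linarith
  obtain C' where C': "C' \<ge> 0"
    "\<And>x. (1 + \<bar>x\<bar> / r) ^ n * exp (- c * \<bar>x\<bar>) \<le> C' * exp (- (c / 2) * \<bar>x\<bar>)"
    using power_times_exp_bounded[OF c(1) r] by metis
  define E where "E = exp ((R + real n) * ln 2 + R * (pi / 2))"
  show ?thesis
  proof (rule that[OF r])
    show "integrable lborel (\<lambda>x. E * C * C' * exp (- (c / 2) * \<bar>x\<bar>))"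
      using c by (intro integrable_mult_right integrable_exp_neg_abs) simp
    show "ball z r \<subseteq> {z. Re z > 0}" using ball_subset_cball sub by (rule subset_trans)
    fix y and x :: real assume "y \<in> ball z r"
    then have y: "y \<in> cball z r" by auto
    have yR: "\<bar>Re y\<bar> \<le> R" "\<bar>Im y\<bar> \<le> R"
      using nrm[OF y] abs_Re_le_cmod[of y] abs_Im_le_cmod[of y] by (auto simp: R_def)
    have "norm (complex_binomial (\<i> * y) (of_real x))
       \<le> exp ((Re (\<i> * y) + real n) * ln 2 + Im (\<i> * y) * (pi / 2)) * (1 + \<bar>x\<bar> / Im (\<i> * y)) ^ n"
      using Re[OF y] r yR n by (intro norm_complex_binomial_le) auto
    also have "\<dots> \<le> E * (1 + \<bar>x\<bar> / r) ^ n"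
    proof (intro mult_mono power_mono)
      have "(Re (\<i> * y) + real n) * ln 2 \<le> (R + real n) * ln 2"
        using yR by (intro mult_right_mono) auto
      moreover have "Im (\<i> * y) * (pi / 2) \<le> R * (pi / 2)"
        using yR by (intro mult_right_mono) auto
      ultimately show "exp ((Re (\<i> * y) + real n) * ln 2 + Im (\<i> * y) * (pi / 2)) \<le> E"
        unfolding E_def exp_le_cancel_iff by (rule add_mono)
      have "\<bar>x\<bar> / Re y \<le> \<bar>x\<bar> / r"
        using Re[OF y] r by (intro divide_left_mono mult_pos_pos) auto
      then show "1 + \<bar>x\<bar> / Im (\<i> * y) \<le> 1 + \<bar>x\<bar> / r" by simp
      show "0 \<le> 1 + \<bar>x\<bar> / Im (\<i> * y)" "0 \<le> (1 + \<bar>x\<bar> / Im (\<i> * y)) ^ n" "0 \<le> E"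
        using Re[OF y] r by (simp_all add: E_def)
    qed
    finally have "norm (complex_binomial (\<i> * y) (of_real x)) \<le> E * (1 + \<bar>x\<bar> / r) ^ n" .
    then have "norm (complex_binomial (\<i> * y) (of_real x) * sech (of_real pi * of_real x / y))
       \<le> (E * (1 + \<bar>x\<bar> / r) ^ n) * (C * exp (- c * \<bar>x\<bar>))"
      unfolding norm_mult using r by (intro mult_mono sech y) (auto simp: E_def)
    also have "\<dots> = E * C * ((1 + \<bar>x\<bar> / r) ^ n * exp (- c * \<bar>x\<bar>))" by simp
    also have "\<dots> \<le> E * C * (C' * exp (- (c / 2) * \<bar>x\<bar>))"
      using c(2) by (intro mult_left_mono C'(2)) (auto simp: E_def)
    finally show "norm (complex_binomial (\<i> * y) (of_real x) * sech (of_real pi * of_real x / y))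
       \<le> E * C * C' * exp (- (c / 2) * \<bar>x\<bar>)" by (simp only: mult_ac)
  qed
qed

section \<open>Integrability and holomorphy of the left-hand side\<close>

lemma sech_measurable [measurable]: "sech \<in> borel_measurable borel"
  unfolding sech_def[abs_def] by measurable

lemma binomial_sech_measurable:
  "(\<lambda>x::real. complex_binomial (\<i> * z) (of_real x) * sech (of_real pi * of_real x / z)) \<in> borel_measurable lborel"
proof -
  have "rGamma \<in> borel_measurable (borel :: complex measure)"
    by (intro borel_measurable_continuous_onI continuous_intros)
  then show ?thesis unfolding complex_binomial_def by measurable
qed

lemma binomial_sech_integrable:
  assumes "Re z > 0"
  shows "integrable lborel (\<lambda>x::real. complex_binomial (\<i> * z) (of_real x) * sech (of_real pi * of_real x / z))"
proof -
  obtain r g where r: "r > 0" and g: "integrable lborel g"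
    and le: "\<And>y x::real. y \<in> ball z r \<Longrightarrow>
       norm (complex_binomial (\<i> * y) (of_real x) * sech (of_real pi * of_real x / y)) \<le> g x"
    using binomial_sech_dominated[OF assms] by metis
  show ?thesis
  proof (rule Bochner_Integration.integrable_bound[OF g binomial_sech_measurable AE_I2])
    fix x
    have "norm (complex_binomial (\<i> * z) (of_real x) * sech (of_real pi * of_real x / z)) \<le> g x"
      using le[of z x] r by simp
    also have "\<dots> \<le> norm (g x)" by simp
    finally show "norm (complex_binomial (\<i> * z) (of_real x) * sech (of_real pi * of_real x / z)) \<le> norm (g x)" .
  qed
qed

lemma binomial_sech_integral_holomorphic:
  "(\<lambda>z. LINT x|lborel. complex_binomial (\<i> * z) (of_real x) * sech (of_real pi * of_real x / z))
     holomorphic_on {z. Re z > 0}"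
proof (rule holomorphic_on_lebesgue_integral[OF open_halfspace_Re_gt binomial_sech_measurable])
  fix x :: real
  have cosh_hol: "(\<lambda>z. cosh (of_real pi * of_real x / z)) holomorphic_on {z. Re z > 0}"
    unfolding cosh_conv_cos by (intro holomorphic_intros) auto
  show "(\<lambda>z. complex_binomial (\<i> * z) (of_real x) * sech (of_real pi * of_real x / z)) holomorphic_on {z. Re z > 0}"
    unfolding complex_binomial_def sech_def
  proof (intro holomorphic_intros cosh_hol)
    show "cosh (of_real pi * of_real x / z) \<noteq> 0" if "z \<in> {z. Re z > 0}" for z
      using cosh_of_real_div_nonzero[of z "pi * x"] that by simp
    show "\<i> * z + 1 \<notin> \<int>\<^sub>\<le>\<^sub>0" if "z \<in> {z. Re z > 0}" for z
      using that by (auto elim!: nonpos_Ints_cases' simp: complex_eq_iff)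
  qed
next
  fix z assume "z \<in> {z. Re z > 0}"
  then show "\<exists>r>0. \<exists>g. integrable lborel g \<and> (\<forall>y\<in>ball z r \<inter> {z. Re z > 0}. \<forall>x\<in>space lborel.
     norm (complex_binomial (\<i> * y) (of_real x) * sech (of_real pi * of_real x / y)) \<le> g x)"
    using binomial_sech_dominated[of z] by (metis IntD1 mem_Collect_eq)
qed

section \<open>Evaluation for real positive alpha\<close>

lemma sech_integrable:
  fixes a :: real
  assumes "a > 0"
  shows "integrable lborel (\<lambda>x. sech (of_real (pi * x / a)))"
proof -
  have "{of_real a} \<subseteq> {z. Re z > 0}" "compact {of_real a :: complex}" using assms by auto
  from norm_sech_le[OF this] obtain C c where c: "c > 0" "C \<ge> 0"
    and le: "\<And>z x. z \<in> {of_real a} \<Longrightarrow> norm (sech (of_real pi * of_real x / z)) \<le> C * exp (- c * \<bar>x\<bar>)"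
    by metis
  show ?thesis
  proof (rule Bochner_Integration.integrable_bound)
    show "integrable lborel (\<lambda>x. C * exp (- c * \<bar>x\<bar>))"
      using c by (intro integrable_mult_right integrable_exp_neg_abs) simp
    show "AE x in lborel. norm (sech (of_real (pi * x / a))) \<le> norm (C * exp (- c * \<bar>x\<bar>))"
      using le c(2) by (intro AE_I2) simp
  qed measurable
qed

lemma binomial_sech_integral_real:
  fixes a :: real
  assumes a: "a > 0"
  defines "w \<equiv> \<i> * of_real a"
  shows "(LINT x|lborel. complex_binomial w (of_real x) * sech (of_real pi * of_real x / of_real a))
    = of_real a * exp (w * of_real (ln 2)) / of_real pi * cosint w 0"
proof -
  let ?S = "{-pi/2<..<pi/2} :: real set"
  have w: "Re w \<ge> 0" by (simp add: w_def)
  define h where "h x = sech (of_real (pi * x / a))" for x :: real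
  \<comment> \<open>The indicator is built into the kernel so that Fubini's theorem applies on the
    whole plane.\<close>
  define k where "k t = indicator ?S t *\<^sub>R cosker w w t" for t :: real
  define G where "G x t = k t * (exp (- 2 * \<i> * of_real (x * t)) * h x)" for x t :: real
  have h_int: "integrable lborel h" unfolding h_def by (rule sech_integrable[OF a])
  have k_int: "integrable lborel k"
    unfolding k_def using cosker_set_integrable[OF w] by (simp add: set_integrable_def)
  have [measurable]: "h \<in> borel_measurable borel" unfolding h_def by measurable
  have [measurable]: "k \<in> borel_measurable borel" unfolding k_def by measurable
  \<comment> \<open>The oscillating factor has modulus one for real x and t, so absolute
    integrability on the plane reduces to that of \<open>h\<close> and \<open>k\<close>.\<close>
  have normG: "norm (G x t) = norm (h x) * norm (k t)" for x t
    by (simp add: G_def norm_mult)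
  have G_int: "integrable (lborel \<Otimes>\<^sub>M lborel) (case_prod G)"
  proof (rule lborel_pair.Fubini_integrable)
    show "case_prod G \<in> borel_measurable (lborel \<Otimes>\<^sub>M lborel)"
      unfolding G_def by measurable
    show "integrable lborel (\<lambda>x. LINT t|lborel. norm (case (x, t) of (x, t) \<Rightarrow> G x t))"
      using h_int by (simp add: normG)
    show "AE x in lborel. integrable lborel (\<lambda>t. case (x, t) of (x, t) \<Rightarrow> G x t)"
    proof (rule AE_I2)
      fix x :: real
      have "integrable lborel (\<lambda>t. G x t)"
      proof (rule Bochner_Integration.integrable_bound)
        show "integrable lborel (\<lambda>t. norm (h x) * norm (k t))" using k_int by simp
        show "AE t in lborel. norm (G x t) \<le> norm (norm (h x) * norm (k t))" by (simp add: normG)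
      qed (unfold G_def, measurable)
      then show "integrable lborel (\<lambda>t. case (x, t) of (x, t) \<Rightarrow> G x t)" by simp
    qed
  qed
  have shift: "cosker w (w - 2 * of_real x) t = cosker w w t * exp (- 2 * \<i> * of_real (x * t))" for x t
    by (simp add: cosker_def exp_add[symmetric] algebra_simps)
  have inner: "cosint w (w - 2 * of_real x) * h x = (LINT t|lborel. G x t)" for x
  proof -
    have "cosint w (w - 2 * of_real x) * h x
        = (LINT t|lborel. indicator ?S t *\<^sub>R cosker w (w - 2 * of_real x) t * h x)"
      unfolding cosint_def set_lebesgue_integral_def by (rule integral_mult_left_zero[symmetric])
    also have "(\<lambda>t. indicator ?S t *\<^sub>R cosker w (w - 2 * of_real x) t * h x) = G x"
      by (simp add: fun_eq_iff G_def k_def shift)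
    finally show ?thesis .
  qed
  have outer: "(LINT x|lborel. G x t) = k t * (of_real a * sech (of_real (a * t)))" for t
  proof -
    have "(LINT x|lborel. G x t) = k t * (LINT x|lborel. exp (- 2 * \<i> * of_real (x * t)) * h x)"
      unfolding G_def by (rule integral_mult_right_zero)
    then show ?thesis unfolding h_def sech_fourier[OF a] .
  qed
  \<comment> \<open>\<open>p (-1)\<close> is, up to the factor \<open>a\<close>, what remains after
    the x-integration, and \<open>p 1\<close> is its mirror image. Each is integrable on its own
    because \<open>exp (\<bar>a * t\<bar>)\<close> is at most
    \<open>2 * cosh (a * t)\<close>.\<close>
  define p where "p s t = indicator ?S t *\<^sub>R (cosker w 0 t * (exp (s * of_real (a * t)) * sech (of_real (a * t))))"
    for s :: complex and t :: real
  have p_int: "integrable lborel (p s)" if "s = 1 \<or> s = -1" for s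
  proof (rule Bochner_Integration.integrable_bound)
    show "integrable lborel (\<lambda>t. 2 * norm (indicator ?S t *\<^sub>R cosker w 0 t))"
      using cosker_set_integrable[OF w, of 0] unfolding set_integrable_def
      by (intro integrable_mult_right integrable_norm)
    show "AE t in lborel. norm (p s t) \<le> norm (2 * norm (indicator ?S t *\<^sub>R cosker w 0 t))"
    proof (rule AE_I2)
      fix t
      have "exp (Re s * (a * t)) \<le> exp \<bar>a * t\<bar>" using that by auto
      also have "\<dots> \<le> 2 * cosh (a * t)" using exp_abs_le_cosh[of "a * t"] by simp
      finally have "norm (exp (s * of_real (a * t)) * sech (of_real (a * t))) \<le> 2"
        using cosh_real_pos[of "a * t"]
        unfolding sech_def cosh_of_real norm_mult norm_divide norm_of_real norm_exp_eq_Re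
        by (simp add: divide_le_eq)
      then have "norm (p s t) \<le> norm (indicator ?S t *\<^sub>R cosker w 0 t) * 2"
        unfolding p_def scaleR_scaleR[symmetric] mult_scaleR_left[symmetric] norm_mult
        by (intro mult_left_mono) auto
      then show "norm (p s t) \<le> norm (2 * norm (indicator ?S t *\<^sub>R cosker w 0 t))" by simp
    qed
  qed (unfold p_def, measurable)
  have refl: "(LINT t|lborel. p (-1) t) = (LINT t|lborel. p 1 t)"
  proof -
    have "(LINT t|lborel. p (-1) t) = \<bar>-1\<bar> *\<^sub>R (LINT t|lborel. p (-1) (0 + (-1) * t))"
      by (rule lborel_integral_real_affine) simp
    also have "(\<lambda>t. p (-1) (0 + (-1) * t)) = p 1"
      by (auto simp: fun_eq_iff p_def cosker_def sech_def indicator_def)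
    finally show ?thesis by simp
  qed
  have p_add: "p (-1) t + p 1 t = 2 * (indicator ?S t *\<^sub>R cosker w 0 t)" for t
  proof -
    have nz: "cosh (of_real (a * t)) \<noteq> (0 :: complex)"
      unfolding cosh_of_real using cosh_real_pos[of "a * t"] by simp
    have "exp (- 1 * of_real (a * t)) * sech (of_real (a * t)) + exp (1 * of_real (a * t)) * sech (of_real (a * t))
       = (exp (- of_real (a * t)) + exp (of_real (a * t))) / cosh (of_real (a * t) :: complex)"
      by (simp add: sech_def add_divide_distrib)
    also have "exp (- of_real (a * t)) + exp (of_real (a * t)) = 2 * cosh (of_real (a * t) :: complex)"
      by (simp add: cosh_field_def)
    also have "2 * cosh (of_real (a * t)) / cosh (of_real (a * t) :: complex) = 2" using nz by simp
    finally have "exp (- 1 * of_real (a * t)) * sech (of_real (a * t)) + exp (1 * of_real (a * t)) * sech (of_real (a * t)) = 2" .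
    then show ?thesis
      unfolding p_def scaleR_add_right[symmetric] distrib_left[symmetric] by simp
  qed
  have "(LINT t|lborel. p (-1) t) + (LINT t|lborel. p 1 t) = (LINT t|lborel. p (-1) t + p 1 t)"
    by (intro Bochner_Integration.integral_add[symmetric] p_int) simp_all
  also have "\<dots> = 2 * cosint w 0"
    unfolding p_add cosint_def set_lebesgue_integral_def by (rule integral_mult_right_zero)
  finally have half: "(LINT t|lborel. p (-1) t) = cosint w 0" unfolding refl by simp
  have kp: "k t * (of_real a * sech (of_real (a * t))) = of_real a * p (-1) t" for t
  proof -
    have "cosker w w t = cosker w 0 t * exp (-1 * of_real (a * t))"
      by (simp add: cosker_def w_def exp_add[symmetric] algebra_simps)
    then show ?thesis by (simp add: k_def p_def)
  qed
  have "complex_binomial w (of_real x) * sech (of_real pi * of_real x / of_real a)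
      = exp (w * of_real (ln 2)) / of_real pi * (LINT t|lborel. G x t)" for x
    unfolding inner[symmetric] complex_binomial_eq_cosint[OF w] h_def by simp
  then have "(LINT x|lborel. complex_binomial w (of_real x) * sech (of_real pi * of_real x / of_real a))
      = exp (w * of_real (ln 2)) / of_real pi * (LINT x|lborel. LINT t|lborel. G x t)"
    by (simp only: integral_mult_right_zero)
  also have "(LINT x|lborel. LINT t|lborel. G x t) = (LINT t|lborel. LINT x|lborel. G x t)"
    using lborel_pair.Fubini_integral[OF G_int] by simp
  also have "\<dots> = of_real a * cosint w 0"
    unfolding outer kp half[symmetric] by (rule integral_mult_right_zero)
  finally show ?thesis by simp
qed

text \<open>At \<open>u = 0\<close> both reciprocal factors are
  \<open>1 / Gamma (w / 2 + 1)\<close>, and one of them cancels against the numerator.\<close>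

lemma cosint_0:
  assumes "Re w \<ge> 0"
  shows "cosint w 0 = of_real (sqrt pi) * (Gamma (w / 2 + 1 / 2) / Gamma (w / 2 + 1))"
proof -
  have "Gamma (w / 2 + 1) \<noteq> 0"
    using assms by (intro Gamma_nonzero not_nonpos_Int_if_Re_pos) auto
  moreover have "(1 + w) / 2 = w / 2 + 1 / 2" by (simp add: field_simps)
  ultimately show ?thesis
    unfolding cosint_eq[OF assms] by (simp add: rGamma_inverse_Gamma field_simps)
qed

section \<open>Continuation to the half-plane\<close>

theorem mainTheorem10:
  fixes \<alpha> :: complex
  assumes "Re \<alpha> > 0" and "Im \<alpha> > -1"
  shows "integrable lborel
           (\<lambda>x::real. complex_binomial (\<i> * \<alpha>) (complex_of_real x)
                       * sech (complex_of_real pi * complex_of_real x / \<alpha>))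
       \<and> (LINT x|lborel. complex_binomial (\<i> * \<alpha>) (complex_of_real x)
                       * sech (complex_of_real pi * complex_of_real x / \<alpha>))
         = \<alpha> * exp (\<i> * \<alpha> * complex_of_real (ln 2)) / complex_of_real (sqrt pi)
           * (Gamma (\<i> * \<alpha> / 2 + 1 / 2) / Gamma (\<i> * \<alpha> / 2 + 1))"
proof
  let ?H = "{z. Re z > 0}"
  let ?L = "\<lambda>z. LINT x|lborel. complex_binomial (\<i> * z) (of_real x) * sech (of_real pi * of_real x / z)"
  let ?R = "\<lambda>z. z * exp (\<i> * z * of_real (ln 2)) / of_real (sqrt pi)
           * (Gamma (\<i> * z / 2 + 1 / 2) / Gamma (\<i> * z / 2 + 1))"
  show "integrable lborel
           (\<lambda>x::real. complex_binomial (\<i> * \<alpha>) (complex_of_real x)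
                       * sech (complex_of_real pi * complex_of_real x / \<alpha>))"
    by (rule binomial_sech_integrable[OF assms(1)])
  \<comment> \<open>Both arguments have imaginary part \<open>Re z / 2\<close>, hence are not real.
    The first fact makes the numerator holomorphic, the second also keeps the denominator from being
    zero.\<close>
  have notin: "\<i> * z / 2 + 1 / 2 \<notin> \<int>\<^sub>\<le>\<^sub>0" "\<i> * z / 2 + 1 \<notin> \<int>\<^sub>\<le>\<^sub>0" if "z \<in> ?H" for z
    using that by (auto elim!: nonpos_Ints_cases' simp: complex_eq_iff)
  have "?L \<alpha> - ?R \<alpha> = 0"
  proof (rule analytic_continuation[of "\<lambda>z. ?L z - ?R z" ?H "of_real ` {0<..}" 1])
    show "(\<lambda>z. ?L z - ?R z) holomorphic_on ?H"
      using notin by (intro holomorphic_intros binomial_sech_integral_holomorphic) (auto simp: Gamma_eq_zero_iff)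
    show "connected ?H" by (intro convex_connected convex_halfspace_Re_gt)
    show "(1::complex) islimpt of_real ` {0<..}"
      unfolding islimpt_approachable
    proof (intro allI impI)
      fix e :: real assume "e > 0"
      then show "\<exists>x'\<in>of_real ` {0<..}. x' \<noteq> (1::complex) \<and> dist x' 1 < e"
        by (intro bexI[of _ "of_real (1 + e / 2)"] imageI) (auto simp: dist_norm)
    qed
    fix z :: complex assume "z \<in> of_real ` {0<..}"
    then obtain a where a: "a > 0" "z = of_real a" by auto
    have sq: "of_real pi = (of_real (sqrt pi) * of_real (sqrt pi) :: complex)"
      unfolding of_real_mult[symmetric] by simp
    have "?L z = z * exp (\<i> * z * of_real (ln 2)) / of_real pi * cosint (\<i> * z) 0"
      unfolding a(2) by (rule binomial_sech_integral_real[OF a(1)])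
    also have "cosint (\<i> * z) 0 = of_real (sqrt pi) * (Gamma (\<i> * z / 2 + 1 / 2) / Gamma (\<i> * z / 2 + 1))"
      by (rule cosint_0) (simp add: a)
    also have "z * exp (\<i> * z * of_real (ln 2)) / of_real pi *
        (of_real (sqrt pi) * (Gamma (\<i> * z / 2 + 1 / 2) / Gamma (\<i> * z / 2 + 1))) = ?R z"
      unfolding sq by simp
    finally show "?L z - ?R z = 0" by simp
  qed (use assms open_halfspace_Re_gt in auto)
  then show "?L \<alpha> = ?R \<alpha>" by simp
qed

end
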